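(* For any partitions $\mu\subset\lambda$, one has $$\omega(U_{\lambda/\mu})=U_{\lambda'/\mu'},$$ where $\lambda'$ and $\mu'$ denote the conjugate partitions of $\lambda$ and $\mu$.
   Context: An integer sequence (integer vector) is a sequence $\alpha=(\alpha_1,\alpha_2,\ldots)$ of integers with only finitely many nonzero terms; it is a partition if $\alpha_i\ge\alpha_{i+1}\ge 0$ for all $i$. For partitions, $\mu\subset\lambda$ means $\mu_i\le\lambda_i$ for all $i$, i.e. containment of Young diagrams, and $\lambda/\mu$ is the resulting skew diagram. The conjugate partition is given by $\lambda'_i=\#\{j\mid\lambda_j\ge i\}$. Let $\mathbb{A}=\mathbb{Z}[u_1,u_2,\ldots]$ be the polynomial ring in countably many independent variables, with $u_0=1$ and $u_r=0$ for $r<0$. For an integer vector $\alpha$ put $u_\alpha=\prod_i u_{\alpha_i}$. For $i<j$ let $R_{ij}(\alpha)=(\alpha_1,\ldots,\alpha_i+1,\ldots,\alpha_j-1,\ldots)$; a raising operator $R$ is a monomial in the $R_{ij}$, and $R\,u_\alpha:=u_{R\alpha}$ (the operator acts on the index $\alpha$). The Schur polynomial of an integer vector $\alpha$ is $$U_\alpha:=\prod_{i<j}(1-R_{ij})\,u_\alpha\in\mathbb{A};$$ after formal expansion only finitely many summands are nonzero. The $U_\lambda$ for $\lambda$ a partition form a $\mathbb{Z}$-basis of $\mathbb{A}$. The Kostka numbers $K_{\lambda/\mu,\alpha}$ are defined by $u_\alpha\,U_\mu=\sum_{\lambda\supset\mu}K_{\lambda/\mu,\alpha}\,U_\lambda$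 (sum over partitions $\lambda\supset\mu$); for $\alpha$ a composition with $|\alpha|=|\lambda/\mu|$, $K_{\lambda/\mu,\alpha}$ is the number of semistandard tableaux of shape $\lambda/\mu$ and content $\alpha$. Write $K_{\lambda,\mu}$ when the inner shape is empty. The matrix $\{K_{\lambda,\mu}\}$ indexed by partitions is lower unitriangular with respect to dominance order, so the equations $U_\lambda=\sum_\mu K_{\lambda,\mu}\,t_\mu$ define a $\mathbb{Z}$-basis $\{t_\lambda\}$ of $\mathbb{A}$ indexed by partitions. The skew Schur polynomial is $U_{\lambda/\mu}:=\sum_\nu K_{\lambda/\mu,\nu}\,t_\nu$ (sum over partitions $\nu$). The map $\omega:\mathbb{A}\to\mathbb{A}$ is the ring homomorphism with $\omega(u_r)=U_{(1^r)}$ for all $r\ge 1$, where $(1^r)$ is the partition with $r$ parts equal to $1$. *)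

theory Defs
  imports Complex_Main "HOL-Library.Poly_Mapping"
begin

text \<open>All sequences are indexed from 0: entry \<open>i\<close> of a vector is \<open>\<alpha>\<^sub>i\<^sub>+\<^sub>1\<close> in the usual
  one-based notation.\<close>

type_synonym int_vec = "nat \<Rightarrow>\<^sub>0 int"

definition is_partition :: "int_vec \<Rightarrow> bool" where
  "is_partition \<alpha> \<longleftrightarrow>
     (\<forall>i. Poly_Mapping.lookup \<alpha> i \<ge> Poly_Mapping.lookup \<alpha> (Suc i) \<and> Poly_Mapping.lookup \<alpha> (Suc i) \<ge> 0)"

definition young_le :: "int_vec \<Rightarrow> int_vec \<Rightarrow> bool" where
  "young_le mu lam \<longleftrightarrow> (\<forall>i. Poly_Mapping.lookup mu i \<le> Poly_Mapping.lookup lam i)"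

lift_definition conj_part :: "int_vec \<Rightarrow> int_vec" is
  "\<lambda>\<alpha> i. int (card {j. \<alpha> j \<ge> int i + 1})"
proof -
  fix \<alpha> :: "nat \<Rightarrow> int"
  assume fin: "finite {i. \<alpha> i \<noteq> 0}"
  have "{i. int (card {j. \<alpha> j \<ge> int i + 1}) \<noteq> 0} \<subseteq> (\<Union>j\<in>{j. \<alpha> j \<noteq> 0}. {..<nat (\<alpha> j)})"
  proof
    fix i assume "i \<in> {i. int (card {j. \<alpha> j \<ge> int i + 1}) \<noteq> 0}"
    then have "{j. \<alpha> j \<ge> int i + 1} \<noteq> {}" by (metis (mono_tags, lifting) card.empty mem_Collect_eq of_nat_0)
    then obtain j where "\<alpha> j \<ge> int i + 1" by blast
    then show "i \<in> (\<Union>j\<in>{j. \<alpha> j \<noteq> 0}. {..<nat (\<alpha> j)})" by (intro UN_I[of j]) auto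
  qed
  then show "finite {i. int (card {j. \<alpha> j \<ge> int i + 1}) \<noteq> 0}"
    by (rule finite_subset) (use fin in auto)
qed

text \<open>The polynomial ring over the integers in countably many variables, as finitely
  supported functions from exponent vectors to coefficients. Variable number \<open>k\<close> plays the
  role of \<open>u\<^sub>k\<^sub>+\<^sub>1\<close>.\<close>

type_synonym poly_ring = "(nat \<Rightarrow>\<^sub>0 nat) \<Rightarrow>\<^sub>0 int"

definition u_gen :: "int \<Rightarrow> poly_ring" where
  "u_gen r = (if r < 0 then 0 else if r = 0 then 1
          else Poly_Mapping.single (Poly_Mapping.single (nat r - 1) 1) 1)"

definition u_vec :: "int_vec \<Rightarrow> poly_ring" where
  "u_vec \<alpha> = (\<Prod>i\<in>Poly_Mapping.keys \<alpha>. u_gen (Poly_Mapping.lookup \<alpha> i))"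

definition raise_vec :: "(nat \<times> nat) set \<Rightarrow> int_vec \<Rightarrow> int_vec" where
  "raise_vec S \<alpha> = \<alpha> + (\<Sum>(i, j)\<in>S. Poly_Mapping.single i 1 - Poly_Mapping.single j 1)"

text \<open>Expanding the infinite product of the factors \<open>1 - R\<^sub>i\<^sub>j\<close> over \<open>i < j\<close> gives one term
  \<open>(-1)\<^sup>|\<^sup>S\<^sup>|\<close> \<open>\<Prod>\<^sub>(\<^sub>i\<^sub>,\<^sub>j\<^sub>)\<^sub>\<in>\<^sub>S R\<^sub>i\<^sub>j\<close> for every finite set \<open>S\<close> of such pairs; only the finitely many
  nonzero terms are summed.\<close>

definition schur_terms :: "int_vec \<Rightarrow> (nat \<times> nat) set set" where
  "schur_terms \<alpha> = {S. finite S \<and> S \<subseteq> {(i, j). i < j} \<and> u_vec (raise_vec S \<alpha>) \<noteq> 0}"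

definition schur :: "int_vec \<Rightarrow> poly_ring" where
  "schur \<alpha> = (\<Sum>S\<in>schur_terms \<alpha>. (- 1) ^ card S * u_vec (raise_vec S \<alpha>))"

lemma lookup_sum_pm:
  "Poly_Mapping.lookup (\<Sum>x\<in>S. f x) k = (\<Sum>x\<in>S. Poly_Mapping.lookup (f x) k)"
  by (induction S rule: infinite_finite_induct) (auto simp: lookup_add)

lemma finite_schur_terms: "finite (schur_terms \<alpha>)"
proof -
  obtain n where n: "\<And>i. i \<in> Poly_Mapping.keys \<alpha> \<Longrightarrow> i < n"
    using finite_nat_set_iff_bounded finite_keys by metis
  have "S \<subseteq> {..<n} \<times> {..<n}" if S: "S \<in> schur_terms \<alpha>" for S
  proof (rule ccontr)
    assume neg: "\<not> S \<subseteq> {..<n} \<times> {..<n}"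
    have fin: "finite S" and lt: "\<And>i j. (i, j) \<in> S \<Longrightarrow> i < j" and nz: "u_vec (raise_vec S \<alpha>) \<noteq> 0"
      using S by (auto simp: schur_terms_def)
    from neg obtain i0 j0 where ij0: "(i0, j0) \<in> S" "j0 \<ge> n"
      using lt by fastforce
    define m where "m = Max (snd ` S)"
    have m_in: "m \<in> snd ` S" unfolding m_def using fin ij0 by (intro Max_in) auto
    have m_max: "j \<le> m" if "(i, j) \<in> S" for i j
      unfolding m_def using fin that by (intro Max_ge) (auto simp: image_iff intro!: bexI)
    have "m \<ge> n" using m_max[OF ij0(1)] ij0(2) by simp
    then have am: "Poly_Mapping.lookup \<alpha> m = 0" using n not_le by (metis in_keys_iff)
    from m_in obtain i1 where i1: "(i1, m) \<in> S" by auto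
    define f where "f = (\<lambda>(i, j). Poly_Mapping.lookup (Poly_Mapping.single i 1 - Poly_Mapping.single j (1::int)) m)"
    have le: "f x \<le> 0" if "x \<in> S" for x
      using that lt m_max by (cases x) (fastforce simp: f_def lookup_minus lookup_single when_def)
    have "f (i1, m) < 0" using lt[OF i1] by (auto simp: f_def lookup_minus lookup_single when_def)
    then have "(\<Sum>x\<in>S. f x) < (\<Sum>x\<in>S. 0)"
      using fin le i1 by (intro sum_strict_mono_ex1) auto
    then have neg: "Poly_Mapping.lookup (raise_vec S \<alpha>) m < 0"
      by (simp add: raise_vec_def lookup_add am lookup_sum_pm f_def case_prod_beta)
    then have "m \<in> Poly_Mapping.keys (raise_vec S \<alpha>)" by (simp add: in_keys_iff)
    moreover have "u_gen (Poly_Mapping.lookup (raise_vec S \<alpha>) m) = 0" using neg by (simp add: u_gen_def)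
    ultimately have "u_vec (raise_vec S \<alpha>) = 0"
      unfolding u_vec_def by (intro prod_zero) auto
    with nz show False by simp
  qed
  then have "schur_terms \<alpha> \<subseteq> Pow ({..<n} \<times> {..<n})" by blast
  then show ?thesis by (rule finite_subset) simp
qed

text \<open>The coefficients of \<open>u\<^sub>\<alpha> U\<^sub>\<mu>\<close> in the basis of Schur polynomials of partitions; they are
  unique since these form a basis.\<close>

definition kostka_coeffs :: "int_vec \<Rightarrow> int_vec \<Rightarrow> (int_vec \<Rightarrow>\<^sub>0 int)" where
  "kostka_coeffs mu \<alpha> = (THE c.
     (\<forall>lam\<in>Poly_Mapping.keys c. is_partition lam \<and> young_le mu lam) \<and>
     u_vec \<alpha> * schur mu = (\<Sum>lam\<in>Poly_Mapping.keys c. of_int (Poly_Mapping.lookup c lam) * schur lam))"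

definition kostka :: "int_vec \<Rightarrow> int_vec \<Rightarrow> int_vec \<Rightarrow> int" where
  "kostka lam mu \<alpha> = Poly_Mapping.lookup (kostka_coeffs mu \<alpha>) lam"

text \<open>The empty inner shape is the zero vector. The value of \<open>t\<close> off partitions is fixed to 0
  so that the description is unique.\<close>

definition t_basis :: "int_vec \<Rightarrow> poly_ring" where
  "t_basis = (THE t. (\<forall>mu. \<not> is_partition mu \<longrightarrow> t mu = 0) \<and>
     (\<forall>lam. is_partition lam \<longrightarrow>
        schur lam = (\<Sum>mu | is_partition mu \<and> kostka lam 0 mu \<noteq> 0. of_int (kostka lam 0 mu) * t mu)))"

definition skew_schur :: "int_vec \<Rightarrow> int_vec \<Rightarrow> poly_ring" where
  "skew_schur lam mu =
     (\<Sum>nu | is_partition nu \<and> kostka lam mu nu \<noteq> 0. of_int (kostka lam mu nu) * t_basis nu)"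

definition is_ring_hom :: "('a::ring_1 \<Rightarrow> 'b::ring_1) \<Rightarrow> bool" where
  "is_ring_hom f \<longleftrightarrow> f 1 = 1 \<and> (\<forall>x y. f (x + y) = f x + f y) \<and> (\<forall>x y. f (x * y) = f x * f y)"

definition column_part :: "nat \<Rightarrow> int_vec" where
  "column_part r = (\<Sum>i<r. Poly_Mapping.single i 1)"

definition omega_hom :: "poly_ring \<Rightarrow> poly_ring" where
  "omega_hom = (THE w. is_ring_hom w \<and> (\<forall>r\<ge>1. w (u_gen (int r)) = schur (column_part r)))"

end

theory Submission
  imports Defs "HOL-Combinatorics.Transposition"
begin

text \<open>The proof is a comparison of structure constants. Write
\<open>U\<^sub>\<rho> U\<^sub>\<mu> = \<Sum>\<^sub>\<kappa> c(\<rho>, \<mu>; \<kappa>) U\<^sub>\<kappa>\<close>, the sum being over partitions. Expanding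
\<open>u\<^sub>\<nu> U\<^sub>\<mu>\<close> through \<open>u\<^sub>\<nu> = \<Sum>\<^sub>\<rho> K(\<rho>, \<nu>) U\<^sub>\<rho>\<close> expresses the skew Kostka numbers by the
straight ones, and the defining relation \<open>U\<^sub>\<rho> = \<Sum>\<^sub>\<nu> K(\<rho>, \<nu>) t\<^sub>\<nu>\<close> then eliminates the
\<open>t\<^sub>\<nu>\<close>: the skew Schur polynomial of \<open>\<kappa>/\<mu>\<close> is \<open>\<Sum>\<^sub>\<rho> c(\<rho>, \<mu>; \<kappa>) U\<^sub>\<rho>\<close>
(\<open>skew_schur_eq\<close>). So it suffices that \<open>\<omega>\<close> sends \<open>U\<^sub>\<kappa>\<close> to the Schur polynomial
of the conjugate partition (\<open>omega_schur\<close>): since \<open>\<omega>\<close> is multiplicative, the structure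
constants are then invariant under conjugating all three partitions.

That \<open>\<omega>\<close> acts by conjugation follows from two Pieri rules: multiplication by \<open>u\<^sub>p\<close> adds
horizontal strips (\<open>pieri\<close>), multiplication by \<open>\<omega>(u\<^sub>p) = U\<^sub>(\<^sub>1\<^sub>,\<^sub>.\<^sub>.\<^sub>.\<^sub>,\<^sub>1\<^sub>)\<close> adds vertical strips
(\<open>vertical_pieri\<close>), and conjugation exchanges the two kinds of strips. The horizontal rule is
obtained from the raising operators: the factors \<open>1 - R\<^sub>i\<^sub>n\<close> belonging to one new last index
are inverted one at a time, which writes \<open>u\<^sub>p U\<^sub>\<kappa>\<close> as a sum of \<open>U\<^sub>\<beta>\<close> over compositions
\<open>\<beta>\<close> containing \<open>\<kappa>\<close>, and a sign-reversing involution based on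
\<open>U\<^sub>(\<^sub>.\<^sub>.\<^sub>.\<^sub>,\<^sub>r\<^sub>,\<^sub>s\<^sub>,\<^sub>.\<^sub>.\<^sub>.\<^sub>) = - U\<^sub>(\<^sub>.\<^sub>.\<^sub>.\<^sub>,\<^sub>s\<^sub>-\<^sub>1\<^sub>,\<^sub>r\<^sub>+\<^sub>1\<^sub>,\<^sub>.\<^sub>.\<^sub>.\<^sub>)\<close> (\<open>schur_alternating\<close>) cancels everything but
horizontal strips. The vertical rule follows from the horizontal one by a second involution
(\<open>alternating_strips\<close>).

The coefficients above make sense because the \<open>U\<^sub>\<kappa>\<close> form a basis. They span, since
their span contains 1 and is stable under all \<open>u\<^sub>p\<close> by the Pieri rule. They are independent,
and the Kostka matrix is unitriangular, because a raising operator applied to a partition increases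
the sum of the squares of the entries, so that \<open>U\<^sub>\<kappa>\<close> has the lowest term \<open>u\<^sub>\<kappa>\<close>
(\<open>schur_leading_term\<close>).\<close>

section \<open>Partial products of raising operators\<close>

abbreviation lk :: "int_vec \<Rightarrow> nat \<Rightarrow> int" where
  "lk \<equiv> Poly_Mapping.lookup"

abbreviation unit_vec :: "nat \<Rightarrow> int_vec" where
  "unit_vec i \<equiv> Poly_Mapping.single i 1"

lemma lk_unit_vec: "lk (unit_vec i) k = (if k = i then 1 else 0)"
  by (auto simp: lookup_single when_def)

lemma u_gen_0 [simp]: "u_gen 0 = 1"
  by (simp add: u_gen_def)

lemma u_gen_neg [simp]: "r < 0 \<Longrightarrow> u_gen r = 0"
  by (simp add: u_gen_def)

lemma u_vec_prod:
  assumes "finite A" "Poly_Mapping.keys \<alpha> \<subseteq> A"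
  shows "u_vec \<alpha> = (\<Prod>i\<in>A. u_gen (lk \<alpha> i))"
  unfolding u_vec_def using assms
  by (intro prod.mono_neutral_left) (auto simp: in_keys_iff)

lemma u_vec_0 [simp]: "u_vec 0 = 1"
  by (simp add: u_vec_def)

lemma u_vec_neg: "lk \<alpha> i < 0 \<Longrightarrow> u_vec \<alpha> = 0"
  unfolding u_vec_def
  by (rule prod_zero) (auto intro!: bexI[of _ i] simp: in_keys_iff)

lemma u_vec_permute:
  assumes "bij f"
  shows "u_vec (Poly_Mapping.map_key f \<alpha>) = u_vec \<alpha>"
proof -
  have inj: "inj f" using assms by (rule bij_is_inj)
  have "u_vec \<alpha> = (\<Prod>i\<in>f ` (f -` Poly_Mapping.keys \<alpha>). u_gen (lk \<alpha> i))"
    using assms by (simp add: u_vec_def bij_is_surj)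
  also have "\<dots> = (\<Prod>i\<in>f -` Poly_Mapping.keys \<alpha>. u_gen (lk \<alpha> (f i)))"
    by (subst prod.reindex) (auto intro: inj_on_subset[OF inj])
  also have "\<dots> = u_vec (Poly_Mapping.map_key f \<alpha>)"
    by (simp add: u_vec_def keys_map_key[OF inj] map_key.rep_eq[OF inj])
  finally show ?thesis ..
qed

lemma u_vec_add_single:
  assumes "lk \<alpha> n = 0"
  shows "u_vec (\<alpha> + Poly_Mapping.single n p) = u_gen p * u_vec \<alpha>"
proof -
  let ?A = "insert n (Poly_Mapping.keys \<alpha>)"
  have n: "n \<notin> Poly_Mapping.keys \<alpha>" using assms by (simp add: in_keys_iff)
  have "Poly_Mapping.keys (\<alpha> + Poly_Mapping.single n p) \<subseteq> ?A"
    using keys_add[of \<alpha> "Poly_Mapping.single n p"] by (auto split: if_splits)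
  then have "u_vec (\<alpha> + Poly_Mapping.single n p) = (\<Prod>i\<in>?A. u_gen (lk (\<alpha> + Poly_Mapping.single n p) i))"
    by (intro u_vec_prod) auto
  also have "\<dots> = u_gen p * (\<Prod>i\<in>Poly_Mapping.keys \<alpha>. u_gen (lk (\<alpha> + Poly_Mapping.single n p) i))"
    using assms n by (simp add: lookup_add)
  also have "(\<Prod>i\<in>Poly_Mapping.keys \<alpha>. u_gen (lk (\<alpha> + Poly_Mapping.single n p) i)) = u_vec \<alpha>"
    unfolding u_vec_def using n by (intro prod.cong) (auto simp: lookup_add lookup_single when_def)
  finally show ?thesis .
qed

lemma raise_vec_insert:
  assumes "finite S" "(i, j) \<notin> S"
  shows "raise_vec (insert (i, j) S) \<alpha> = raise_vec S (\<alpha> + unit_vec i - unit_vec j)"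
  using assms by (simp add: raise_vec_def algebra_simps)

lemma raise_vec_add: "raise_vec S (\<alpha> + \<beta>) = raise_vec S \<alpha> + \<beta>"
  by (simp add: raise_vec_def algebra_simps)

lemma lk_raise_vec_le:
  assumes "\<And>j. (m, j) \<notin> S"
  shows "lk (raise_vec S \<alpha>) m \<le> lk \<alpha> m"
proof -
  have "(\<Sum>x\<in>S. lk (case x of (i, j) \<Rightarrow> unit_vec i - unit_vec j) m) \<le> 0"
    by (rule sum_nonpos) (use assms in \<open>auto simp: lookup_minus lk_unit_vec\<close>)
  then show ?thesis by (simp add: raise_vec_def lookup_add lookup_sum_pm)
qed

lemma lk_raise_vec_same:
  assumes "\<And>j. (m, j) \<notin> S" "\<And>j. (j, m) \<notin> S"
  shows "lk (raise_vec S \<alpha>) m = lk \<alpha> m"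
proof -
  have "(\<Sum>x\<in>S. lk (case x of (i, j) \<Rightarrow> unit_vec i - unit_vec j) m) = 0"
    by (rule sum.neutral) (use assms in \<open>auto simp: lookup_minus lk_unit_vec\<close>)
  then show ?thesis by (simp add: raise_vec_def lookup_add lookup_sum_pm)
qed

text \<open>The expansion of a finite subproduct of \<open>\<Prod>(1 - R\<^sub>i\<^sub>j)\<close>. Working with arbitrary finite sets of
pairs allows single factors to be split off, which is how all identities below arise.\<close>

definition partial_schur :: "(nat \<times> nat) set \<Rightarrow> int_vec \<Rightarrow> poly_ring" where
  "partial_schur P \<alpha> = (\<Sum>S\<in>Pow P. (- 1) ^ card S * u_vec (raise_vec S \<alpha>))"

lemma partial_schur_insert:
  assumes "finite P" "(i, j) \<notin> P"
  shows "partial_schur (insert (i, j) P) \<alpha> =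
    partial_schur P \<alpha> - partial_schur P (\<alpha> + unit_vec i - unit_vec j)"
proof -
  have inj: "inj_on (insert (i, j)) (Pow P)"
    using assms(2) by (intro inj_onI) (metis Pow_iff insert_ident subsetD)
  have "partial_schur (insert (i, j) P) \<alpha> = partial_schur P \<alpha>
      + (\<Sum>S\<in>insert (i, j) ` Pow P. (- 1) ^ card S * u_vec (raise_vec S \<alpha>))"
    unfolding partial_schur_def Pow_insert
    by (rule sum.union_disjoint) (use assms in auto)
  also have "(\<Sum>S\<in>insert (i, j) ` Pow P. (- 1) ^ card S * u_vec (raise_vec S \<alpha>))
     = (\<Sum>S\<in>Pow P. (- 1) ^ card (insert (i, j) S) * u_vec (raise_vec (insert (i, j) S) \<alpha>))"
    by (simp add: sum.reindex[OF inj])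
  also have "\<dots> = (\<Sum>S\<in>Pow P. - ((- 1) ^ card S * u_vec (raise_vec S (\<alpha> + unit_vec i - unit_vec j))))"
  proof (rule sum.cong)
    fix S assume "S \<in> Pow P"
    then have "finite S" "(i, j) \<notin> S" using assms by (auto intro: finite_subset)
    then show "(- 1) ^ card (insert (i, j) S) * u_vec (raise_vec (insert (i, j) S) \<alpha>)
      = - ((- 1) ^ card S * u_vec (raise_vec S (\<alpha> + unit_vec i - unit_vec j)))"
      by (simp add: raise_vec_insert)
  qed simp
  also have "\<dots> = - partial_schur P (\<alpha> + unit_vec i - unit_vec j)"
    by (simp add: partial_schur_def sum_negf)
  finally show ?thesis by simp
qed

text \<open>If no factor raises the entry at \<open>m\<close>, this entry can only be lowered further, and each term
contains a variable of negative index.\<close>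

lemma partial_schur_neg:
  assumes "\<And>j. (m, j) \<notin> P" "lk \<alpha> m < 0"
  shows "partial_schur P \<alpha> = 0"
  unfolding partial_schur_def
proof (rule sum.neutral, rule ballI)
  fix S assume "S \<in> Pow P"
  then have "lk (raise_vec S \<alpha>) m \<le> lk \<alpha> m" using assms(1) by (intro lk_raise_vec_le) auto
  then show "(- 1) ^ card S * u_vec (raise_vec S \<alpha>) = 0"
    using assms(2) by (simp add: u_vec_neg[of _ m])
qed

text \<open>Splitting off a factor \<open>1 - R\<^sub>i\<^sub>m\<close> leaves a second term whose entry at \<open>m\<close> is \<open>-1\<close>, and
this term vanishes. Hence indices beyond the length of a vector have no effect, and
the infinite product may be truncated at any bound for the support.\<close>

lemma partial_schur_drop:
  assumes "finite I" "finite P" "\<And>j. (m, j) \<notin> P" "m \<notin> I" "lk \<alpha> m = 0"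
  shows "partial_schur (P \<union> (\<lambda>i. (i, m)) ` I) \<alpha> = partial_schur P \<alpha>"
  using assms(1,4)
proof (induction I)
  case (insert i I)
  let ?P = "P \<union> (\<lambda>i. (i, m)) ` I"
  show ?case
  proof (cases "(i, m) \<in> ?P")
    case True
    then have "insert (i, m) ?P = ?P" by blast
    then show ?thesis using insert by simp
  next
    case False
    have "partial_schur ?P (\<alpha> + unit_vec i - unit_vec m) = 0"
      using insert assms by (intro partial_schur_neg[of m]) (auto simp: lookup_add lookup_minus lk_unit_vec)
    then show ?thesis
      using insert assms(2) partial_schur_insert[OF _ False, of \<alpha>] by simp
  qed
qed simp

definition pairs :: "nat \<Rightarrow> (nat \<times> nat) set" where
  "pairs n = {(i, j). i < j \<and> j < n}"

lemma finite_pairs [simp]: "finite (pairs n)"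
  by (rule finite_subset[of _ "{..<n} \<times> {..<n}"]) (auto simp: pairs_def)

lemma pairs_Suc: "pairs (Suc n) = pairs n \<union> (\<lambda>i. (i, n)) ` {..<n}"
  by (auto simp: pairs_def less_Suc_eq)

lemma partial_schur_pairs_mono:
  assumes "Poly_Mapping.keys \<alpha> \<subseteq> {..<n}" "n \<le> N"
  shows "partial_schur (pairs N) \<alpha> = partial_schur (pairs n) \<alpha>"
  using assms(2)
proof (induction N rule: dec_induct)
  case (step k)
  have "lk \<alpha> k = 0" using assms(1) step(1) by (auto simp: in_keys_iff)
  then have "partial_schur (pairs (Suc k)) \<alpha> = partial_schur (pairs k) \<alpha>"
    unfolding pairs_Suc by (intro partial_schur_drop finite_pairs) (auto simp: pairs_def)
  with step show ?case by simp
qed simp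

lemma schur_eq_partial_schur:
  assumes "Poly_Mapping.keys \<alpha> \<subseteq> {..<n}"
  shows "schur \<alpha> = partial_schur (pairs n) \<alpha>"
proof -
  have "finite (snd ` \<Union>(schur_terms \<alpha>))"
    using finite_schur_terms by (auto simp: schur_terms_def)
  then obtain N where N: "\<And>x. x \<in> snd ` \<Union>(schur_terms \<alpha>) \<Longrightarrow> x < N"
    using finite_nat_set_iff_bounded by metis
  let ?N = "max n N"
  have "schur \<alpha> = partial_schur (pairs ?N) \<alpha>"
    unfolding schur_def partial_schur_def
  proof (rule sum.mono_neutral_left)
    show "schur_terms \<alpha> \<subseteq> Pow (pairs ?N)"
    proof (intro subsetI PowI)
      fix S x assume S: "S \<in> schur_terms \<alpha>" and x: "x \<in> S"
      obtain i j where ij: "x = (i, j)" by (cases x)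
      have "snd x < N" by (rule N) (use S x in blast)
      then show "x \<in> pairs ?N" using S x by (auto simp: schur_terms_def pairs_def)
    qed
    show "\<forall>S\<in>Pow (pairs ?N) - schur_terms \<alpha>. (- 1) ^ card S * u_vec (raise_vec S \<alpha>) = 0"
      using finite_subset[OF _ finite_pairs] by (auto simp: schur_terms_def) (auto simp: pairs_def)
  qed simp
  then show ?thesis using partial_schur_pairs_mono[OF assms, of ?N] by simp
qed

lemma keys_bounded: "\<exists>n. Poly_Mapping.keys (\<alpha> :: int_vec) \<subseteq> {..<n} \<and> m \<le> n"
proof -
  have "finite (Poly_Mapping.keys \<alpha> \<union> {..<m})" by simp
  then obtain n where "\<forall>i\<in>Poly_Mapping.keys \<alpha> \<union> {..<m}. i < n"
    using finite_nat_set_iff_bounded by metis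
  then show ?thesis by (intro exI[of _ n]) (auto intro: leI)
qed

lemma keys_bounded_iff: "Poly_Mapping.keys \<alpha> \<subseteq> {..<n} \<longleftrightarrow> (\<forall>i\<ge>n. lk \<alpha> i = 0)"
  by (metis in_keys_iff lessThan_iff not_le subset_iff)

lemma map_key_minus:
  assumes "inj f" shows "Poly_Mapping.map_key f (\<alpha> - \<beta> :: int_vec) = Poly_Mapping.map_key f \<alpha> - Poly_Mapping.map_key f \<beta>"
  by (rule poly_mapping_eqI) (simp add: map_key.rep_eq[OF assms] lookup_minus)

lemma map_key_sum:
  assumes "inj f" shows "Poly_Mapping.map_key f (\<Sum>x\<in>S. g x :: int_vec) = (\<Sum>x\<in>S. Poly_Mapping.map_key f (g x))"
  by (rule poly_mapping_eqI) (simp add: map_key.rep_eq[OF assms] lookup_sum_pm)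

lemma map_key_transpose_unit_vec:
  "Poly_Mapping.map_key (transpose a b) (unit_vec k) = unit_vec (transpose a b k)"
proof -
  have "Poly_Mapping.map_key (transpose a b) (Poly_Mapping.single (transpose a b (transpose a b k)) (1::int))
    = unit_vec (transpose a b k)"
    by (rule map_key_single) simp
  then show ?thesis by simp
qed

lemma raise_vec_transpose:
  fixes a b :: nat
  defines "\<tau> \<equiv> transpose a b"
  shows "raise_vec (map_prod \<tau> \<tau> ` S) (Poly_Mapping.map_key \<tau> \<alpha>) = Poly_Mapping.map_key \<tau> (raise_vec S \<alpha>)"
proof -
  have inj: "inj \<tau>" by (simp add: \<tau>_def)
  have inj2: "inj_on (map_prod \<tau> \<tau>) S"
    using prod.inj_map[OF inj inj] by (rule inj_on_subset) simp
  show ?thesis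
    unfolding raise_vec_def map_key_plus[OF inj] map_key_sum[OF inj] sum.reindex[OF inj2]
    by (intro arg_cong2[of _ _ _ _ "(+)"] refl sum.cong)
       (auto simp: map_key_minus \<tau>_def map_key_transpose_unit_vec)
qed

lemma partial_schur_transpose:
  fixes a b :: nat
  defines "\<tau> \<equiv> transpose a b"
  assumes "map_prod \<tau> \<tau> ` P = P"
  shows "partial_schur P (Poly_Mapping.map_key \<tau> \<alpha>) = partial_schur P \<alpha>"
proof -
  have inj: "inj (map_prod \<tau> \<tau>)" by (simp add: \<tau>_def prod.inj_map)
  have Pow: "Pow P = (`) (map_prod \<tau> \<tau>) ` Pow P"
    by (rule image_Pow_surj[symmetric, OF assms(2)])
  have inj_image: "inj_on ((`) (map_prod \<tau> \<tau>)) (Pow P)"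
    using inj by (intro inj_on_subset[OF inj_on_image[of _ UNIV]]) auto
  have "partial_schur P (Poly_Mapping.map_key \<tau> \<alpha>) = (\<Sum>S\<in>(`) (map_prod \<tau> \<tau>) ` Pow P.
      (- 1) ^ card S * u_vec (raise_vec S (Poly_Mapping.map_key \<tau> \<alpha>)))"
    unfolding partial_schur_def using Pow by simp
  also have "\<dots> = (\<Sum>S\<in>Pow P. (- 1) ^ card (map_prod \<tau> \<tau> ` S)
      * u_vec (raise_vec (map_prod \<tau> \<tau> ` S) (Poly_Mapping.map_key \<tau> \<alpha>)))"
    by (simp add: sum.reindex[OF inj_image])
  also have "\<dots> = partial_schur P \<alpha>"
    unfolding partial_schur_def
  proof (rule sum.cong)
    fix S
    have "card (map_prod \<tau> \<tau> ` S) = card S"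
      using inj by (intro card_image) (auto intro: inj_on_subset)
    moreover have "u_vec (raise_vec (map_prod \<tau> \<tau> ` S) (Poly_Mapping.map_key \<tau> \<alpha>)) = u_vec (raise_vec S \<alpha>)"
      unfolding \<tau>_def by (simp add: raise_vec_transpose u_vec_permute)
    ultimately show "(- 1) ^ card (map_prod \<tau> \<tau> ` S) * u_vec (raise_vec (map_prod \<tau> \<tau> ` S) (Poly_Mapping.map_key \<tau> \<alpha>))
      = (- 1) ^ card S * u_vec (raise_vec S \<alpha>)" by simp
  qed simp
  finally show ?thesis .
qed

text \<open>The set of pairs without \<open>(i, i+1)\<close> is invariant under the transposition of \<open>i\<close> and
\<open>i+1\<close>, and so is \<open>u_vec\<close>. The remaining factor \<open>1 - R\<^sub>i\<^sub>,\<^sub>i\<^sub>+\<^sub>1\<close> produces two terms, which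
the transposition exchanges up to sign.\<close>

lemma schur_alternating:
  assumes 1: "lk \<beta> i = lk \<alpha> (Suc i) - 1" and 2: "lk \<beta> (Suc i) = lk \<alpha> i + 1"
    and rest: "\<And>k. k \<noteq> i \<Longrightarrow> k \<noteq> Suc i \<Longrightarrow> lk \<beta> k = lk \<alpha> k"
  shows "schur \<beta> = - schur \<alpha>"
proof -
  define \<tau> where "\<tau> = transpose i (Suc i)"
  obtain n where n: "Poly_Mapping.keys \<alpha> \<subseteq> {..<n}" "i + 2 \<le> n"
    using keys_bounded by blast
  have n': "Poly_Mapping.keys \<beta> \<subseteq> {..<n}"
    using n rest unfolding keys_bounded_iff by simp
  let ?Q = "pairs n - {(i, Suc i)}"
  have pairs: "pairs n = insert (i, Suc i) ?Q" using n by (auto simp: pairs_def)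
  have sub: "map_prod \<tau> \<tau> ` ?Q \<subseteq> ?Q"
    using n(2) by (auto simp: pairs_def \<tau>_def transpose_def split: if_splits)
  have "map_prod \<tau> \<tau> ` map_prod \<tau> \<tau> ` ?Q = ?Q"
    by (simp add: image_image \<tau>_def map_prod_def case_prod_beta)
  then have Q: "map_prod \<tau> \<tau> ` ?Q = ?Q"
    using sub image_mono[OF sub, of "map_prod \<tau> \<tau>"] by (simp add: subset_antisym)
  have \<beta>: "\<beta> = Poly_Mapping.map_key \<tau> (\<alpha> + unit_vec i - unit_vec (Suc i))"
    by (rule poly_mapping_eqI)
       (auto simp: \<tau>_def map_key.rep_eq transpose_def lookup_add lookup_minus lk_unit_vec 1 2 rest)
  have \<beta>': "\<beta> + unit_vec i - unit_vec (Suc i) = Poly_Mapping.map_key \<tau> \<alpha>"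
    by (rule poly_mapping_eqI)
       (auto simp: \<tau>_def map_key.rep_eq transpose_def lookup_add lookup_minus lk_unit_vec 1 2 rest)
  have ins: "partial_schur (pairs n) \<gamma> =
      partial_schur ?Q \<gamma> - partial_schur ?Q (\<gamma> + unit_vec i - unit_vec (Suc i))" for \<gamma>
    by (subst pairs, rule partial_schur_insert) auto
  have inv: "partial_schur ?Q (Poly_Mapping.map_key \<tau> \<gamma>) = partial_schur ?Q \<gamma>" for \<gamma>
    using Q unfolding \<tau>_def by (rule partial_schur_transpose)
  have "schur \<beta> = partial_schur ?Q \<beta> - partial_schur ?Q (\<beta> + unit_vec i - unit_vec (Suc i))"
    using schur_eq_partial_schur[OF n'] ins by simp
  also have "\<dots> = partial_schur ?Q (\<alpha> + unit_vec i - unit_vec (Suc i)) - partial_schur ?Q \<alpha>"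
    unfolding \<beta>' by (simp add: inv) (simp add: \<beta> inv)
  also have "\<dots> = - schur \<alpha>"
    using schur_eq_partial_schur[OF n(1)] ins by simp
  finally show ?thesis .
qed

section \<open>The Pieri rule for horizontal strips\<close>

definition weight :: "int_vec \<Rightarrow> int" where
  "weight \<alpha> = (\<Sum>i\<in>Poly_Mapping.keys \<alpha>. lk \<alpha> i)"

lemma weight_sum:
  assumes "finite A" "Poly_Mapping.keys \<alpha> \<subseteq> A"
  shows "weight \<alpha> = (\<Sum>i\<in>A. lk \<alpha> i)"
  unfolding weight_def using assms by (intro sum.mono_neutral_left) (auto simp: in_keys_iff)

lemma weight_add: "weight (\<alpha> + \<beta>) = weight \<alpha> + weight \<beta>"
proof -
  let ?A = "Poly_Mapping.keys \<alpha> \<union> Poly_Mapping.keys \<beta>"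
  have "weight \<gamma> = (\<Sum>i\<in>?A. lk \<gamma> i)" if "\<gamma> \<in> {\<alpha>, \<beta>, \<alpha> + \<beta>}" for \<gamma>
    using that by (intro weight_sum) (auto dest: subsetD[OF keys_add])
  then show ?thesis by (simp add: lookup_add sum.distrib)
qed

lemma weight_single [simp]: "weight (Poly_Mapping.single i c) = c"
  by (simp add: weight_def)

lemma weight_diff: "weight (\<alpha> - \<beta>) = weight \<alpha> - weight \<beta>"
proof -
  have "weight \<alpha> = weight ((\<alpha> - \<beta>) + \<beta>)" by simp
  then show ?thesis by (simp only: weight_add)
qed

lemma weight_0 [simp]: "weight 0 = 0"
  by (simp add: weight_def)

lemma weight_mono:
  assumes "\<And>i. lk \<alpha> i \<le> lk \<beta> i"
  shows "weight \<alpha> \<le> weight \<beta>"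
proof -
  let ?A = "Poly_Mapping.keys \<alpha> \<union> Poly_Mapping.keys \<beta>"
  have "weight \<alpha> = (\<Sum>i\<in>?A. lk \<alpha> i)" "weight \<beta> = (\<Sum>i\<in>?A. lk \<beta> i)"
    by (rule weight_sum; simp)+
  then show ?thesis using assms by (simp add: sum_mono)
qed

lemma lk_le_weight:
  assumes "\<And>i. 0 \<le> lk \<alpha> i"
  shows "lk \<alpha> i \<le> weight \<alpha>"
proof (cases "i \<in> Poly_Mapping.keys \<alpha>")
  case True
  then show ?thesis unfolding weight_def using assms by (intro member_le_sum) auto
next
  case False
  then show ?thesis unfolding weight_def using assms by (simp add: in_keys_iff sum_nonneg)
qed

lemma finite_bounded_vectors:
  "finite {\<beta>. (\<forall>i\<ge>n. lk \<beta> i = 0) \<and> (\<forall>i. 0 \<le> lk \<beta> i) \<and> weight \<beta> = w}" (is "finite ?B")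
proof -
  let ?F = "{f. \<forall>i. (i \<in> {..<n} \<longrightarrow> f i \<in> {0..w}) \<and> (i \<notin> {..<n} \<longrightarrow> f i = 0)}"
  have "lk ` ?B \<subseteq> ?F"
    by (auto simp: not_less lk_le_weight)
  moreover have "finite ?F" by (rule finite_set_of_finite_funs) auto
  ultimately have "finite (lk ` ?B)" by (rule finite_subset)
  then show ?thesis by (rule finite_imageD) (simp add: inj_on_def)
qed

lemma partition_nonneg: "is_partition \<kappa> \<Longrightarrow> 0 \<le> lk \<kappa> i"
  unfolding is_partition_def using order_trans[of 0 "lk \<kappa> (Suc i)" "lk \<kappa> i"] by simp

lemma partition_antimono: "is_partition \<kappa> \<Longrightarrow> i \<le> j \<Longrightarrow> lk \<kappa> j \<le> lk \<kappa> i"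
  by (rule lift_Suc_antimono_le) (auto simp: is_partition_def)

text \<open>Sums that a sign-reversing bijection maps to their negatives vanish by this; fixed points of the
bijection need no separate treatment because the ring has no 2-torsion.\<close>

lemma self_neg_eq_0:
  fixes x :: poly_ring
  assumes "x = - x"
  shows "x = 0"
proof (rule poly_mapping_eqI)
  fix k
  have "Poly_Mapping.lookup x k = - Poly_Mapping.lookup x k"
    using arg_cong[OF assms, of "\<lambda>y. Poly_Mapping.lookup y k"] by simp
  then show "Poly_Mapping.lookup x k = Poly_Mapping.lookup 0 k" by simp
qed

text \<open>The vectors obtained from \<open>\<kappa>\<close> by distributing \<open>p\<close> units over the positions below \<open>m\<close>
and the position \<open>n\<close>, where \<open>n\<close> is an index beyond the length of \<open>\<kappa>\<close>.\<close>

definition overlays :: "nat \<Rightarrow> nat \<Rightarrow> int_vec \<Rightarrow> nat \<Rightarrow> int_vec set" where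
  "overlays m n \<kappa> p = {\<beta>. (\<forall>i. lk \<kappa> i \<le> lk \<beta> i) \<and> (\<forall>i\<ge>m. i \<noteq> n \<longrightarrow> lk \<beta> i = lk \<kappa> i)
     \<and> weight \<beta> = weight \<kappa> + int p}"

lemma finite_overlays:
  assumes "is_partition \<kappa>" "Poly_Mapping.keys \<kappa> \<subseteq> {..<n}" "m \<le> n"
  shows "finite (overlays m n \<kappa> p)"
proof -
  have "0 \<le> lk \<beta> i" if "\<beta> \<in> overlays m n \<kappa> p" for \<beta> i
    using that partition_nonneg[OF assms(1), of i] order_trans[of 0 "lk \<kappa> i" "lk \<beta> i"]
    by (simp add: overlays_def)
  then have "overlays m n \<kappa> p \<subseteq> {\<beta>. (\<forall>i\<ge>Suc n. lk \<beta> i = 0) \<and> (\<forall>i. 0 \<le> lk \<beta> i) \<and> weight \<beta> = weight \<kappa> + int p}"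
    using assms unfolding keys_bounded_iff by (auto simp: overlays_def)
  then show ?thesis by (rule finite_subset) (rule finite_bounded_vectors)
qed

text \<open>This inverts the factor \<open>1 - R\<^sub>m\<^sub>n\<close>: formally, \<open>x = \<Sum>\<^sub>k R\<^sub>m\<^sub>n\<^sup>k (1 - R\<^sub>m\<^sub>n) x\<close>, where only finitely many
terms survive since a negative entry at \<open>n\<close> gives 0. In the difference of sums that arises from
splitting off the factor, \<open>R\<^sub>m\<^sub>n\<close> shifts the index set onto the vectors whose entry at \<open>m\<close>
exceeds that of \<open>\<kappa>\<close>, up to vectors that contribute 0.\<close>

lemma overlays_telescope:
  assumes "is_partition \<kappa>" "Poly_Mapping.keys \<kappa> \<subseteq> {..<n}" "m < n"
  defines "P \<equiv> \<lambda>m. pairs n \<union> (\<lambda>i. (i, n)) ` {..<m}"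
  shows "(\<Sum>\<beta>\<in>overlays (Suc m) n \<kappa> p. partial_schur (P (Suc m)) \<beta>) =
         (\<Sum>\<beta>\<in>overlays m n \<kappa> p. partial_schur (P m) \<beta>)"
proof -
  let ?C = "\<lambda>m. overlays m n \<kappa> p"
  let ?sh = "\<lambda>\<beta>. \<beta> + unit_vec m - unit_vec n"
  let ?f = "partial_schur (P m)"
  have fin: "finite (?C (Suc m))" "finite (?C m)"
    using assms(3) by (intro finite_overlays[OF assms(1,2)]; simp)+
  have \<kappa>n: "lk \<kappa> n = 0" using assms(2) unfolding keys_bounded_iff by simp
  have sub: "?C m \<subseteq> ?C (Suc m)" by (auto simp: overlays_def)
  have P: "P (Suc m) = insert (m, n) (P m)" by (auto simp: P_def lessThan_Suc)
  have "partial_schur (P (Suc m)) \<beta> = ?f \<beta> - ?f (?sh \<beta>)" for \<beta>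
    unfolding P by (rule partial_schur_insert) (simp add: P_def, auto simp: P_def pairs_def)
  then have "(\<Sum>\<beta>\<in>?C (Suc m). partial_schur (P (Suc m)) \<beta>) =
      (\<Sum>\<beta>\<in>?C (Suc m). ?f \<beta>) - (\<Sum>\<beta>\<in>?C (Suc m). ?f (?sh \<beta>))"
    by (simp add: sum_subtractf)
  also have "(\<Sum>\<beta>\<in>?C (Suc m). ?f (?sh \<beta>)) = sum ?f (?sh ` ?C (Suc m))"
    by (subst sum.reindex) (auto intro: inj_onI)
  also have "\<dots> = sum ?f (?C (Suc m) - ?C m)"
  proof (rule sum.mono_neutral_right)
    show "finite (?sh ` ?C (Suc m))" using fin by simp
    show "?C (Suc m) - ?C m \<subseteq> ?sh ` ?C (Suc m)"
    proof
      fix \<beta> assume \<beta>: "\<beta> \<in> ?C (Suc m) - ?C m"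
      have "lk \<beta> m \<noteq> lk \<kappa> m"
      proof
        assume eq: "lk \<beta> m = lk \<kappa> m"
        have "lk \<beta> i = lk \<kappa> i" if "m \<le> i" "i \<noteq> n" for i
          using \<beta> eq that by (cases "i = m") (auto simp: overlays_def)
        with \<beta> show False by (simp add: overlays_def) blast
      qed
      moreover have "lk \<kappa> m \<le> lk \<beta> m" using \<beta> by (auto simp: overlays_def)
      ultimately have m: "lk \<kappa> m + 1 \<le> lk \<beta> m" by simp
      have "lk \<kappa> i \<le> lk \<beta> i" for i using \<beta> by (auto simp: overlays_def)
      then have "\<beta> - unit_vec m + unit_vec n \<in> ?C (Suc m)"
        using \<beta> m assms(3)
        by (auto simp: overlays_def lookup_add lookup_minus lk_unit_vec weight_add weight_diff add_increasing2)
      moreover have "\<beta> = ?sh (\<beta> - unit_vec m + unit_vec n)" by simp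
      ultimately show "\<beta> \<in> ?sh ` ?C (Suc m)" by blast
    qed
    show "\<forall>\<beta>\<in>?sh ` ?C (Suc m) - (?C (Suc m) - ?C m). ?f \<beta> = 0"
    proof
      fix \<beta> assume \<beta>: "\<beta> \<in> ?sh ` ?C (Suc m) - (?C (Suc m) - ?C m)"
      then obtain \<gamma> where \<gamma>: "\<gamma> \<in> ?C (Suc m)" "\<beta> = ?sh \<gamma>" by blast
      have ge: "lk \<kappa> i \<le> lk \<gamma> i" for i using \<gamma> by (auto simp: overlays_def)
      have "lk \<beta> m > lk \<kappa> m"
        using ge[of m] assms(3) \<gamma>(2) by (simp add: lookup_add lookup_minus lk_unit_vec)
      then have "\<beta> \<notin> ?C m" using assms(3) by (auto simp: overlays_def)
      then have no: "\<beta> \<notin> ?C (Suc m)" using \<beta> by blast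
      have "lk \<beta> n < 0"
      proof (rule ccontr)
        assume n: "\<not> lk \<beta> n < 0"
        have "lk \<kappa> i \<le> lk \<beta> i" for i
          using n ge[of i] \<gamma>(2) \<kappa>n by (cases "i = n") (auto simp: lookup_add lookup_minus lk_unit_vec)
        then have "\<beta> \<in> ?C (Suc m)"
          using \<gamma> by (auto simp: overlays_def lookup_add lookup_minus lk_unit_vec weight_add weight_diff)
        with no show False ..
      qed
      then show "?f \<beta> = 0"
        using assms(3) by (intro partial_schur_neg[of n]) (auto simp: P_def pairs_def)
    qed
  qed
  also have "sum ?f (?C (Suc m)) - sum ?f (?C (Suc m) - ?C m) = sum ?f (?C m)"
    using sum.subset_diff[OF sub fin(1), of ?f] by simp
  finally show ?thesis .
qed

text \<open>Multiplying \<open>U\<^sub>\<kappa>\<close> by \<open>u\<^sub>p\<close> appends \<open>p\<close> as a new last entry without the factors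
\<open>1 - R\<^sub>i\<^sub>n\<close>; putting these factors back one by one spreads \<open>p\<close> over all positions.\<close>

lemma u_gen_mult_schur_overlays:
  assumes \<kappa>: "is_partition \<kappa>" and n: "Poly_Mapping.keys \<kappa> \<subseteq> {..<n}"
  shows "u_gen (int p) * schur \<kappa> = (\<Sum>\<beta>\<in>overlays n n \<kappa> p. schur \<beta>)"
proof -
  let ?P = "\<lambda>m. pairs n \<union> (\<lambda>i. (i, n)) ` {..<m}"
  let ?\<alpha> = "\<kappa> + Poly_Mapping.single n (int p)"
  have \<kappa>n: "lk \<kappa> n = 0" using n unfolding keys_bounded_iff by simp
  have tel: "(\<Sum>\<beta>\<in>overlays m n \<kappa> p. partial_schur (?P m) \<beta>) =
      (\<Sum>\<beta>\<in>overlays 0 n \<kappa> p. partial_schur (?P 0) \<beta>)" if "m \<le> n" for m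
    using that
  proof (induction m)
    case (Suc m)
    then show ?case using overlays_telescope[OF \<kappa> n, of m p] by simp
  qed simp
  have "overlays 0 n \<kappa> p = {?\<alpha>}"
  proof (intro equalityI subsetI)
    fix \<beta> assume \<beta>: "\<beta> \<in> overlays 0 n \<kappa> p"
    have "\<beta> = \<kappa> + Poly_Mapping.single n (lk \<beta> n)"
      using \<beta> \<kappa>n by (intro poly_mapping_eqI) (auto simp: overlays_def lookup_add lookup_single when_def)
    moreover from this have "weight \<beta> = weight \<kappa> + lk \<beta> n" by (metis weight_add weight_single)
    ultimately show "\<beta> \<in> {?\<alpha>}" using \<beta> by (simp add: overlays_def)
  qed (auto simp: overlays_def lookup_add lookup_single weight_add when_def)
  then have "(\<Sum>\<beta>\<in>overlays 0 n \<kappa> p. partial_schur (?P 0) \<beta>) = partial_schur (pairs n) ?\<alpha>" by simp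
  also have "\<dots> = (\<Sum>S\<in>Pow (pairs n). u_gen (int p) * ((- 1) ^ card S * u_vec (raise_vec S \<kappa>)))"
    unfolding partial_schur_def
  proof (rule sum.cong)
    fix S assume "S \<in> Pow (pairs n)"
    then have "lk (raise_vec S \<kappa>) n = lk \<kappa> n" by (intro lk_raise_vec_same) (auto simp: pairs_def)
    then show "(- 1) ^ card S * u_vec (raise_vec S ?\<alpha>) = u_gen (int p) * ((- 1) ^ card S * u_vec (raise_vec S \<kappa>))"
      using \<kappa>n by (simp add: raise_vec_add u_vec_add_single)
  qed simp
  also have "\<dots> = u_gen (int p) * schur \<kappa>"
    by (simp add: sum_distrib_left schur_eq_partial_schur[OF n] partial_schur_def)
  finally have "u_gen (int p) * schur \<kappa> = (\<Sum>\<beta>\<in>overlays n n \<kappa> p. partial_schur (?P n) \<beta>)"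
    using tel[of n] by simp
  also have "\<dots> = (\<Sum>\<beta>\<in>overlays n n \<kappa> p. schur \<beta>)"
  proof (rule sum.cong)
    fix \<beta> assume "\<beta> \<in> overlays n n \<kappa> p"
    then have "Poly_Mapping.keys \<beta> \<subseteq> {..<Suc n}"
      using n unfolding keys_bounded_iff overlays_def by auto
    from schur_eq_partial_schur[OF this]
    show "partial_schur (?P n) \<beta> = schur \<beta>" by (simp add: pairs_Suc)
  qed simp
  finally show ?thesis .
qed

text \<open>The interlacing condition \<open>\<mu>\<^sub>0 \<ge> \<kappa>\<^sub>0 \<ge> \<mu>\<^sub>1 \<ge> \<kappa>\<^sub>1 \<ge> ...\<close>, which says that \<open>\<mu>/\<kappa>\<close> has at most one box
in each column.\<close>

definition hstrip :: "int_vec \<Rightarrow> int_vec \<Rightarrow> bool" where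
  "hstrip \<kappa> \<mu> \<longleftrightarrow> (\<forall>i. lk \<kappa> i \<le> lk \<mu> i \<and> lk \<mu> (Suc i) \<le> lk \<kappa> i)"

definition hstrips :: "int_vec \<Rightarrow> nat \<Rightarrow> int_vec set" where
  "hstrips \<kappa> p = {\<mu>. hstrip \<kappa> \<mu> \<and> weight \<mu> = weight \<kappa> + int p}"

lemma hstrip_partition:
  assumes "is_partition \<kappa>" "hstrip \<kappa> \<mu>"
  shows "is_partition \<mu>"
  unfolding is_partition_def
proof
  fix i
  have "lk \<mu> (Suc i) \<le> lk \<kappa> i" "lk \<kappa> i \<le> lk \<mu> i" "lk \<kappa> (Suc i) \<le> lk \<mu> (Suc i)"
    using assms(2) by (auto simp: hstrip_def)
  then show "lk \<mu> (Suc i) \<le> lk \<mu> i \<and> 0 \<le> lk \<mu> (Suc i)"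
    using partition_nonneg[OF assms(1), of "Suc i"] by linarith
qed

lemma hstrips_eq:
  assumes "is_partition \<kappa>" "Poly_Mapping.keys \<kappa> \<subseteq> {..<n}"
  shows "hstrips \<kappa> p = overlays n n \<kappa> p \<inter> Collect (hstrip \<kappa>)"
proof -
  have eq: "lk \<mu> i = lk \<kappa> i" if \<mu>: "hstrip \<kappa> \<mu>" and i: "n \<le> i" "i \<noteq> n" for \<mu> i
  proof -
    obtain j where j: "i = Suc j" "n \<le> j" using i by (cases i) auto
    have "lk \<kappa> i = 0" "lk \<kappa> j = 0" using assms(2) i j unfolding keys_bounded_iff by auto
    moreover have "lk \<kappa> i \<le> lk \<mu> i" "lk \<mu> i \<le> lk \<kappa> j" using \<mu> j unfolding hstrip_def by auto
    ultimately show ?thesis by simp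
  qed
  have "lk \<kappa> i \<le> lk \<mu> i" if "hstrip \<kappa> \<mu>" for \<mu> i
    using that by (simp add: hstrip_def)
  with eq show ?thesis unfolding hstrips_def overlays_def by blast
qed

lemma finite_hstrips: "is_partition \<kappa> \<Longrightarrow> finite (hstrips \<kappa> p)"
proof -
  assume \<kappa>: "is_partition \<kappa>"
  obtain n where "Poly_Mapping.keys \<kappa> \<subseteq> {..<n}" using keys_bounded by blast
  with \<kappa> show ?thesis by (simp add: hstrips_eq finite_overlays)
qed

text \<open>The vectors in the expansion of \<open>u_gen_mult_schur_overlays\<close> that are not horizontal strips
cancel in pairs. Such a \<open>\<beta>\<close> violates \<open>\<beta>\<^sub>i\<^sub>+\<^sub>1 \<le> \<kappa>\<^sub>i\<close> for some \<open>i\<close>; the partner is obtained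
by the alternation at the last such \<open>i\<close>. The last one is taken because the operation changes
\<open>\<beta>\<^sub>i\<close>, which may affect the condition for \<open>i - 1\<close>, but none of the conditions after \<open>i\<close>.\<close>

theorem pieri:
  assumes \<kappa>: "is_partition \<kappa>"
  shows "u_gen (int p) * schur \<kappa> = (\<Sum>\<mu>\<in>hstrips \<kappa> p. schur \<mu>)"
proof -
  obtain n where n: "Poly_Mapping.keys \<kappa> \<subseteq> {..<n}" using keys_bounded by blast
  let ?C = "overlays n n \<kappa> p"
  define D where "D = ?C - Collect (hstrip \<kappa>)"
  define last where "last \<beta> i \<longleftrightarrow> lk \<kappa> i < lk \<beta> (Suc i) \<and> (\<forall>k>i. lk \<beta> (Suc k) \<le> lk \<kappa> k)" for \<beta> i
  define swap where "swap i \<beta> = Poly_Mapping.map_key (transpose i (Suc i)) \<beta> + unit_vec (Suc i) - unit_vec i"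
    for i and \<beta> :: int_vec
  define G where "G \<beta> = swap (THE i. last \<beta> i) \<beta>" for \<beta>
  have lk_swap: "lk (swap i \<beta>) k = (if k = i then lk \<beta> (Suc i) - 1 else if k = Suc i then lk \<beta> i + 1 else lk \<beta> k)"
    for i \<beta> k by (auto simp: swap_def lookup_add lookup_minus lk_unit_vec map_key.rep_eq transpose_def)
  have weight_swap: "weight (swap i \<beta>) = weight \<beta>" for i \<beta>
  proof -
    have "weight (Poly_Mapping.map_key (transpose i (Suc i)) \<beta>) = weight \<beta>"
    proof -
      have "weight \<beta> = (\<Sum>k\<in>transpose i (Suc i) ` (transpose i (Suc i) -` Poly_Mapping.keys \<beta>). lk \<beta> k)"
        by (simp add: weight_def)
      also have "\<dots> = (\<Sum>k\<in>transpose i (Suc i) -` Poly_Mapping.keys \<beta>. lk \<beta> (transpose i (Suc i) k))"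
        by (subst sum.reindex) (auto intro: inj_on_subset[OF inj_transpose])
      finally show ?thesis by (simp add: weight_def keys_map_key map_key.rep_eq)
    qed
    then show ?thesis by (simp add: swap_def weight_add weight_diff)
  qed
  have last_unique: "i = j" if "last \<beta> i" "last \<beta> j" for \<beta> i j
    using that unfolding last_def by (metis linorder_neqE_nat not_less)
  have the_last: "(THE i. last \<beta> i) = i" if "last \<beta> i" for \<beta> i
    using that last_unique by blast
  have ex_last: "\<exists>i. last \<beta> i" if \<beta>: "\<beta> \<in> D" for \<beta>
  proof -
    let ?V = "{i. lk \<kappa> i < lk \<beta> (Suc i)}"
    have "i < n" if "i \<in> ?V" for i
    proof (rule ccontr)
      assume "\<not> i < n"
      then have "lk \<beta> (Suc i) = lk \<kappa> (Suc i)" "lk \<kappa> (Suc i) \<le> lk \<kappa> i"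
        using \<beta> \<kappa> by (auto simp: D_def overlays_def is_partition_def)
      with that show False by simp
    qed
    then have fin: "finite ?V" by (meson finite_nat_set_iff_bounded)
    have "\<not> (\<forall>i. lk \<beta> (Suc i) \<le> lk \<kappa> i)"
      using \<beta> by (auto simp: D_def overlays_def hstrip_def)
    then have ne: "?V \<noteq> {}" by (auto simp: not_le)
    have "last \<beta> (Max ?V)"
      unfolding last_def using Max_in[OF fin ne] Max_ge[OF fin] by (fastforce simp: not_less)
    then show ?thesis ..
  qed
  have G: "G \<beta> \<in> D \<and> G (G \<beta>) = \<beta> \<and> schur (G \<beta>) = - schur \<beta>" if \<beta>: "\<beta> \<in> D" for \<beta>
  proof -
    obtain i where i: "last \<beta> i" using ex_last[OF \<beta>] by blast
    have G\<beta>: "G \<beta> = swap i \<beta>" by (simp add: G_def the_last[OF i])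
    have ge: "lk \<kappa> k \<le> lk \<beta> k" for k using \<beta> by (auto simp: D_def overlays_def)
    have i': "lk \<kappa> i < lk \<beta> (Suc i)" using i by (simp add: last_def)
    have "Suc i \<le> n"
    proof (rule ccontr)
      assume "\<not> Suc i \<le> n"
      then have "lk \<beta> (Suc i) = lk \<kappa> (Suc i)" "lk \<kappa> (Suc i) \<le> lk \<kappa> i"
        using \<beta> \<kappa> by (auto simp: D_def overlays_def is_partition_def)
      with i' show False by simp
    qed
    have i'': "last (G \<beta>) i"
      using i ge[of i] unfolding last_def G\<beta> by (auto simp: lk_swap)
    have "lk \<kappa> (Suc i) \<le> lk \<beta> i + 1"
      using \<kappa> ge[of i] unfolding is_partition_def by (meson add_increasing2 order_trans zero_le_one)
    then have "G \<beta> \<in> ?C"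
      using \<beta> i' ge[of i] \<open>Suc i \<le> n\<close>
      by (auto simp: G\<beta> D_def overlays_def lk_swap weight_swap)
    moreover have "\<not> hstrip \<kappa> (G \<beta>)" using i'' by (auto simp: last_def hstrip_def not_le)
    moreover have "G (G \<beta>) = swap i (G \<beta>)"
      by (simp add: G_def[of "G \<beta>"] the_last[OF i''])
    moreover have "swap i (swap i \<beta>) = \<beta>"
      by (rule poly_mapping_eqI) (simp add: lk_swap)
    moreover have "schur (G \<beta>) = - schur \<beta>"
      unfolding G\<beta> by (rule schur_alternating[of _ i]) (auto simp: lk_swap)
    ultimately show ?thesis by (simp add: D_def G\<beta>)
  qed
  \<comment> \<open>Vectors fixed by the involution satisfy \<open>schur \<beta> = - schur \<beta>\<close> and cancel as well.\<close>
  have "(\<Sum>\<beta>\<in>D. schur \<beta>) = (\<Sum>\<beta>\<in>D. - schur \<beta>)"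
    by (rule sum.reindex_bij_witness[of _ G G]) (use G in auto)
  then have D: "(\<Sum>\<beta>\<in>D. schur \<beta>) = 0" by (intro self_neg_eq_0) (simp add: sum_negf)
  have "finite ?C" using \<kappa> n by (rule finite_overlays) simp
  then have "(\<Sum>\<beta>\<in>?C. schur \<beta>) = (\<Sum>\<beta>\<in>?C \<inter> Collect (hstrip \<kappa>). schur \<beta>) + (\<Sum>\<beta>\<in>D. schur \<beta>)"
    unfolding D_def by (rule sum.Int_Diff)
  then show ?thesis
    by (simp add: u_gen_mult_schur_overlays[OF \<kappa> n] hstrips_eq[OF \<kappa> n] D)
qed

section \<open>Conjugation exchanges horizontal and vertical strips\<close>

lemma downset_eq_lessThan:
  fixes S :: "nat set"
  assumes "finite S" "\<And>i j. i \<in> S \<Longrightarrow> j \<le> i \<Longrightarrow> j \<in> S"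
  shows "S = {..<card S}"
proof -
  define n where "n = (LEAST n. n \<notin> S)"
  have "\<exists>n. n \<notin> S" using assms(1) ex_new_if_finite infinite_UNIV_nat by blast
  then have n: "n \<notin> S" unfolding n_def by (rule LeastI_ex)
  have "i \<in> S" if "i < n" for i using that not_less_Least unfolding n_def by blast
  moreover have "i < n" if "i \<in> S" for i using assms(2)[OF that] n by (meson not_le)
  ultimately have "S = {..<n}" by auto
  then show ?thesis by simp
qed

text \<open>Conjugation transposes the diagram. All facts about conjugate partitions are reduced to this
symmetric description, with inequalities between entries unfolded by \<open>int_le_iff\<close>.\<close>

lemma less_conj_part_iff:
  assumes "is_partition \<kappa>"
  shows "int i < lk (conj_part \<kappa>) j \<longleftrightarrow> int j < lk \<kappa> i"
proof -
  let ?S = "{k. int j + 1 \<le> lk \<kappa> k}"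
  have "finite ?S" by (rule finite_subset[OF _ finite_keys[of \<kappa>]]) (auto simp: in_keys_iff)
  then have "?S = {..<card ?S}"
    by (rule downset_eq_lessThan) (auto intro: order_trans partition_antimono[OF assms])
  then have "i \<in> ?S \<longleftrightarrow> i < card ?S" by blast
  then show ?thesis by (simp add: conj_part.rep_eq add1_zle_eq)
qed

lemma int_le_iff:
  fixes a b :: int
  assumes "0 \<le> b"
  shows "a \<le> b \<longleftrightarrow> (\<forall>k. int k < a \<longrightarrow> int k < b)"
proof
  assume "\<forall>k. int k < a \<longrightarrow> int k < b"
  then have "int (nat b) < a \<longrightarrow> int (nat b) < b" by blast
  then show "a \<le> b" using assms by auto
qed auto

lemma partition_eqI:
  assumes "is_partition \<kappa>" "is_partition \<mu>" "\<And>i k. int k < lk \<kappa> i \<longleftrightarrow> int k < lk \<mu> i"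
  shows "\<kappa> = \<mu>"
proof (rule poly_mapping_eqI)
  fix i
  show "lk \<kappa> i = lk \<mu> i"
    using int_le_iff[of "lk \<kappa> i" "lk \<mu> i"] int_le_iff[of "lk \<mu> i" "lk \<kappa> i"]
      partition_nonneg[OF assms(1)] partition_nonneg[OF assms(2)] assms(3) by (simp add: antisym)
qed

lemma conj_part_nonneg: "0 \<le> lk (conj_part \<kappa>) i"
  by (simp add: conj_part.rep_eq)

lemma is_partition_conj_part:
  assumes "is_partition \<kappa>"
  shows "is_partition (conj_part \<kappa>)"
proof -
  have "lk (conj_part \<kappa>) (Suc i) \<le> lk (conj_part \<kappa>) i" for i
    unfolding int_le_iff[OF conj_part_nonneg] less_conj_part_iff[OF assms] by auto
  then show ?thesis by (simp add: is_partition_def conj_part_nonneg)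
qed

lemma conj_part_conj_part:
  assumes "is_partition \<kappa>"
  shows "conj_part (conj_part \<kappa>) = \<kappa>"
  by (rule partition_eqI)
     (simp_all add: assms is_partition_conj_part less_conj_part_iff)

lemma weight_eq_card_diagram:
  assumes "is_partition \<kappa>"
  shows "weight \<kappa> = int (card {(i, j). int j < lk \<kappa> i})"
proof -
  have "lk \<kappa> i \<noteq> 0" if "int j < lk \<kappa> i" for i j using that by auto
  then have eq: "{(i, j). int j < lk \<kappa> i} = Sigma (Poly_Mapping.keys \<kappa>) (\<lambda>i. {..<nat (lk \<kappa> i)})"
    by (auto simp: in_keys_iff)
  show ?thesis
    unfolding eq by (simp add: weight_def partition_nonneg[OF assms])
qed

lemma weight_conj_part:
  assumes "is_partition \<kappa>"
  shows "weight (conj_part \<kappa>) = weight \<kappa>"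
proof -
  have "{(i, j). int j < lk (conj_part \<kappa>) i} = prod.swap ` {(i, j). int j < lk \<kappa> i}"
    by (auto simp: less_conj_part_iff[OF assms] image_iff)
  then have "card {(i, j). int j < lk (conj_part \<kappa>) i} = card {(i, j). int j < lk \<kappa> i}"
    by (simp add: card_image)
  then show ?thesis
    by (simp add: weight_eq_card_diagram assms is_partition_conj_part)
qed

definition partitions :: "int \<Rightarrow> int_vec set" where
  "partitions N = {\<kappa>. is_partition \<kappa> \<and> weight \<kappa> = N}"

lemma finite_partitions [simp]: "finite (partitions N)"
proof -
  have "lk \<kappa> i = 0" if \<kappa>: "\<kappa> \<in> partitions N" and i: "nat N \<le> i" for \<kappa> i
  proof (rule ccontr)
    have p: "is_partition \<kappa>" "weight \<kappa> = N" using \<kappa> by (auto simp: partitions_def)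
    assume "lk \<kappa> i \<noteq> 0"
    then have "1 \<le> lk \<kappa> i" using partition_nonneg[OF p(1), of i] by simp
    then have ge: "1 \<le> lk \<kappa> j" if "j \<le> i" for j
      using partition_antimono[OF p(1) that] by simp
    have "int i + 1 = (\<Sum>j\<le>i. 1)" by simp
    also have "\<dots> \<le> (\<Sum>j\<le>i. lk \<kappa> j)" by (rule sum_mono) (use ge in auto)
    also have "\<dots> \<le> weight \<kappa>" unfolding weight_def
    proof (rule sum_mono2)
      show "{..i} \<subseteq> Poly_Mapping.keys \<kappa>"
      proof
        fix j assume "j \<in> {..i}"
        then show "j \<in> Poly_Mapping.keys \<kappa>" using ge[of j] by (auto simp: in_keys_iff)
      qed
    qed (auto simp: partition_nonneg[OF p(1)])
    finally show False using i p(2) by simp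
  qed
  then have "partitions N \<subseteq> {\<beta>. (\<forall>i\<ge>nat N. lk \<beta> i = 0) \<and> (\<forall>i. 0 \<le> lk \<beta> i) \<and> weight \<beta> = N}"
    by (simp add: subset_iff) (simp add: partitions_def partition_nonneg)
  then show ?thesis by (rule finite_subset) (rule finite_bounded_vectors)
qed

definition vstrip :: "int_vec \<Rightarrow> int_vec \<Rightarrow> bool" where
  "vstrip \<kappa> \<mu> \<longleftrightarrow> (\<forall>i. lk \<kappa> i \<le> lk \<mu> i \<and> lk \<mu> i \<le> lk \<kappa> i + 1)"

definition vstrips :: "int_vec \<Rightarrow> nat \<Rightarrow> int_vec set" where
  "vstrips \<kappa> r = {\<mu>. is_partition \<mu> \<and> vstrip \<kappa> \<mu> \<and> weight \<mu> = weight \<kappa> + int r}"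

lemma finite_vstrips [simp]: "finite (vstrips \<kappa> r)"
  by (rule finite_subset[OF _ finite_partitions[of "weight \<kappa> + int r"]])
     (auto simp: vstrips_def partitions_def)

lemma hstrip_iff_vstrip_conj_part:
  assumes "is_partition \<kappa>" "is_partition \<mu>"
  shows "hstrip \<kappa> \<mu> \<longleftrightarrow> vstrip (conj_part \<kappa>) (conj_part \<mu>)"
proof -
  have succ: "a \<le> b + 1 \<longleftrightarrow> (\<forall>k. int (Suc k) < a \<longrightarrow> int k < b)" if "0 \<le> b" for a b :: int
  proof
    assume "\<forall>k. int (Suc k) < a \<longrightarrow> int k < b"
    then have "int (Suc (nat b)) < a \<longrightarrow> int (nat b) < b" by blast
    then show "a \<le> b + 1" using that by auto
  qed auto
  have "hstrip \<kappa> \<mu> \<longleftrightarrow> (\<forall>i k. (int k < lk \<kappa> i \<longrightarrow> int k < lk \<mu> i)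
      \<and> (int k < lk \<mu> (Suc i) \<longrightarrow> int k < lk \<kappa> i))"
    using assms by (auto simp: hstrip_def int_le_iff partition_nonneg)
  also have "\<dots> \<longleftrightarrow> vstrip (conj_part \<kappa>) (conj_part \<mu>)"
    by (auto simp: vstrip_def int_le_iff[OF conj_part_nonneg] succ[OF conj_part_nonneg]
        less_conj_part_iff assms simp del: of_nat_Suc)
  finally show ?thesis .
qed

lemma vstrips_conj_part:
  assumes "is_partition \<kappa>"
  shows "vstrips (conj_part \<kappa>) p = conj_part ` hstrips \<kappa> p"
proof (intro equalityI subsetI)
  fix \<mu> assume \<mu>: "\<mu> \<in> vstrips (conj_part \<kappa>) p"
  then have p: "is_partition \<mu>" by (simp add: vstrips_def)
  have "conj_part \<mu> \<in> hstrips \<kappa> p"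
    using \<mu> p assms by (simp add: hstrips_def vstrips_def hstrip_iff_vstrip_conj_part
        is_partition_conj_part conj_part_conj_part weight_conj_part)
  then show "\<mu> \<in> conj_part ` hstrips \<kappa> p"
    using conj_part_conj_part[OF p] by (intro image_eqI[of _ _ "conj_part \<mu>"]) auto
next
  fix \<nu> assume "\<nu> \<in> conj_part ` hstrips \<kappa> p"
  then obtain \<mu> where \<mu>: "\<nu> = conj_part \<mu>" "\<mu> \<in> hstrips \<kappa> p" by blast
  then have "is_partition \<mu>" using hstrip_partition[OF assms] by (simp add: hstrips_def)
  then show "\<nu> \<in> vstrips (conj_part \<kappa>) p"
    using \<mu> assms by (simp add: hstrips_def vstrips_def hstrip_iff_vstrip_conj_part
        is_partition_conj_part weight_conj_part)
qed

section \<open>The Pieri rule for vertical strips\<close>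

text \<open>By the horizontal Pieri rule the left-hand side is a signed sum over chains
\<open>\<kappa> \<subseteq> \<nu> \<subseteq> \<mu>\<close> with \<open>\<nu>/\<kappa>\<close> vertical and \<open>\<mu>/\<nu>\<close> horizontal. In the last row
in which \<open>\<mu>\<close> exceeds \<open>\<kappa>\<close>, exactly two lengths are possible for \<open>\<nu>\<close>, namely that of
\<open>\<kappa>\<close> and one more: the next row of \<open>\<mu>\<close> is that of \<open>\<kappa>\<close> and so not too long. Toggling
between the two changes the sign.\<close>

lemma alternating_strips:
  assumes \<kappa>: "is_partition \<kappa>" and r: "0 < r"
  shows "(\<Sum>i\<le>r. (- 1) ^ i * (u_gen (int i) * (\<Sum>\<nu>\<in>vstrips \<kappa> (r - i). schur \<nu>))) = 0"
proof -
  define T where "T = {(\<nu>, \<mu>). is_partition \<nu> \<and> vstrip \<kappa> \<nu> \<and> hstrip \<nu> \<mu> \<and> weight \<mu> = weight \<kappa> + int r}"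
  define f :: "int_vec \<times> int_vec \<Rightarrow> poly_ring"
    where "f = (\<lambda>(\<nu>, \<mu>). (- 1) ^ nat (weight \<mu> - weight \<nu>) * schur \<mu>)"
  define k where "k \<mu> = Max {k. lk \<kappa> k < lk \<mu> k}" for \<mu>
  define G where "G = (\<lambda>(\<nu>, \<mu>). (if lk \<nu> (k \<mu>) = lk \<kappa> (k \<mu>) then \<nu> + unit_vec (k \<mu>) else \<nu> - unit_vec (k \<mu>), \<mu>))"
  let ?S = "Sigma {..r} (\<lambda>i. Sigma (vstrips \<kappa> (r - i)) (\<lambda>\<nu>. hstrips \<nu> i))"
  have fin: "finite (hstrips \<nu> i)" if "\<nu> \<in> vstrips \<kappa> j" for \<nu> i j
    using that by (simp add: vstrips_def finite_hstrips)
  have wt: "weight \<kappa> \<le> weight \<nu>" "weight \<nu> \<le> weight \<mu>" if "(\<nu>, \<mu>) \<in> T" for \<nu> \<mu>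
  proof -
    have "lk \<kappa> i \<le> lk \<nu> i" "lk \<nu> i \<le> lk \<mu> i" for i
      using that by (auto simp: T_def vstrip_def hstrip_def)
    then show "weight \<kappa> \<le> weight \<nu>" "weight \<nu> \<le> weight \<mu>" by (simp_all add: weight_mono)
  qed
  have "(\<Sum>i\<le>r. (- 1) ^ i * (u_gen (int i) * (\<Sum>\<nu>\<in>vstrips \<kappa> (r - i). schur \<nu>)))
    = (\<Sum>i\<le>r. \<Sum>\<nu>\<in>vstrips \<kappa> (r - i). (- 1) ^ i * (u_gen (int i) * schur \<nu>))"
    by (simp add: sum_distrib_left)
  also have "\<dots> = (\<Sum>i\<le>r. \<Sum>\<nu>\<in>vstrips \<kappa> (r - i). \<Sum>\<mu>\<in>hstrips \<nu> i. (- 1) ^ i * schur \<mu>)"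
    by (intro sum.cong refl) (simp add: vstrips_def pieri sum_distrib_left)
  also have "\<dots> = (\<Sum>i\<le>r. \<Sum>(\<nu>, \<mu>)\<in>Sigma (vstrips \<kappa> (r - i)) (\<lambda>\<nu>. hstrips \<nu> i). (- 1) ^ i * schur \<mu>)"
    by (intro sum.cong refl sum.Sigma) (auto intro: fin)
  also have "\<dots> = (\<Sum>(i, \<nu>, \<mu>)\<in>?S. (- 1) ^ i * schur \<mu>)"
    by (subst sum.Sigma) (auto simp: case_prod_beta intro!: finite_SigmaI fin)
  also have "\<dots> = sum f T"
  proof (rule sum.reindex_bij_witness[of _ "\<lambda>(\<nu>, \<mu>). (nat (weight \<mu> - weight \<nu>), \<nu>, \<mu>)" snd])
    fix a assume a: "a \<in> ?S"
    obtain i \<nu> \<mu> where [simp]: "a = (i, \<nu>, \<mu>)" by (cases a)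
    show "(case snd a of (\<nu>, \<mu>) \<Rightarrow> (nat (weight \<mu> - weight \<nu>), \<nu>, \<mu>)) = a"
      using a by (auto simp: hstrips_def)
    show "snd a \<in> T" using a by (auto simp: T_def hstrips_def vstrips_def)
    show "f (snd a) = (case a of (i, \<nu>, \<mu>) \<Rightarrow> (- 1) ^ i * schur \<mu>)"
      using a by (auto simp: f_def hstrips_def)
  next
    fix b assume b: "b \<in> T"
    obtain \<nu> \<mu> where [simp]: "b = (\<nu>, \<mu>)" by (cases b)
    show "snd (case b of (\<nu>, \<mu>) \<Rightarrow> (nat (weight \<mu> - weight \<nu>), \<nu>, \<mu>)) = b" by simp
    show "(case b of (\<nu>, \<mu>) \<Rightarrow> (nat (weight \<mu> - weight \<nu>), \<nu>, \<mu>)) \<in> ?S"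
      using b wt[of \<nu> \<mu>] by (auto simp: T_def hstrips_def vstrips_def)
  qed
  also have "sum f T = 0"
  proof (rule self_neg_eq_0)
    have main: "G b \<in> T \<and> G (G b) = b \<and> f (G b) = - f b" if b: "b \<in> T" for b
    proof -
      obtain \<nu> \<mu> where b_eq: "b = (\<nu>, \<mu>)" by (cases b)
      have \<nu>: "lk \<kappa> i \<le> lk \<nu> i" "lk \<nu> i \<le> lk \<kappa> i + 1" and \<mu>: "lk \<nu> i \<le> lk \<mu> i" "lk \<mu> (Suc i) \<le> lk \<nu> i"
        and w: "weight \<mu> = weight \<kappa> + int r" for i
        using b by (auto simp: b_eq T_def vstrip_def hstrip_def)
      let ?K = "{k. lk \<kappa> k < lk \<mu> k}"
      have "finite ?K"
        by (rule finite_subset[of _ "Poly_Mapping.keys \<kappa> \<union> Poly_Mapping.keys \<mu>"]) (auto simp: in_keys_iff)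
      moreover have "?K \<noteq> {}"
        using weight_mono[of \<mu> \<kappa>] w r by (auto simp: not_less)
      ultimately have k_in: "k \<mu> \<in> ?K" and k_ge: "\<And>j. j \<in> ?K \<Longrightarrow> j \<le> k \<mu>"
        unfolding k_def using Max_in Max_ge by blast+
      define c where "c = k \<mu>"
      have c: "lk \<kappa> c + 1 \<le> lk \<mu> c" using k_in by (simp add: c_def)
      have "lk \<mu> (Suc c) \<le> lk \<kappa> (Suc c)" 
        by (rule ccontr) (use k_ge[of "Suc c"] in \<open>simp add: c_def\<close>)
      also have "\<dots> \<le> lk \<kappa> c" using \<kappa> by (simp add: is_partition_def)
      finally have c': "lk \<mu> (Suc c) \<le> lk \<kappa> c" .
      define \<nu>' where "\<nu>' = (if lk \<nu> c = lk \<kappa> c then \<nu> + unit_vec c else \<nu> - unit_vec c)"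
      have \<nu>'_lk: "lk \<nu>' i = (if i = c then (if lk \<nu> c = lk \<kappa> c then lk \<kappa> c + 1 else lk \<kappa> c) else lk \<nu> i)" for i
        using \<nu>[of c] by (auto simp: \<nu>'_def lookup_add lookup_minus lk_unit_vec)
      have Gb: "G b = (\<nu>', \<mu>)" by (simp add: G_def b_eq \<nu>'_def c_def)
      have v: "vstrip \<kappa> \<nu>'" using \<nu> by (simp add: vstrip_def \<nu>'_lk)
      have h: "hstrip \<nu>' \<mu>" using \<mu> c c' by (auto simp: hstrip_def \<nu>'_lk)
      have "is_partition \<nu>'"
        unfolding is_partition_def
      proof
        fix i
        have "lk \<mu> (Suc i) \<le> lk \<nu>' i" "lk \<nu>' (Suc i) \<le> lk \<mu> (Suc i)" "lk \<kappa> (Suc i) \<le> lk \<nu>' (Suc i)"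
          using v h by (auto simp: vstrip_def hstrip_def)
        then show "lk \<nu>' (Suc i) \<le> lk \<nu>' i \<and> 0 \<le> lk \<nu>' (Suc i)"
          using partition_nonneg[OF \<kappa>, of "Suc i"] by linarith
      qed
      then have T: "(\<nu>', \<mu>) \<in> T" using v h w by (simp add: T_def)
      have "G (\<nu>', \<mu>) = (\<nu>, \<mu>)"
      proof -
        have "(if lk \<nu>' c = lk \<kappa> c then \<nu>' + unit_vec c else \<nu>' - unit_vec c) = \<nu>"
          by (simp add: \<nu>'_lk) (simp add: \<nu>'_def)
        then show ?thesis by (auto simp: G_def c_def[symmetric] split: if_splits)
      qed
      moreover have "f (\<nu>', \<mu>) = - f (\<nu>, \<mu>)"
      proof -
        have le: "weight \<nu> \<le> weight \<mu>" "weight \<nu>' \<le> weight \<mu>"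
          using wt[OF T] wt b unfolding b_eq by auto
        have "weight \<nu>' = weight \<nu> + 1 \<or> weight \<nu> = weight \<nu>' + 1"
          by (simp add: \<nu>'_def weight_add weight_diff)
        then have "nat (weight \<mu> - weight \<nu>) = Suc (nat (weight \<mu> - weight \<nu>')) \<or>
            nat (weight \<mu> - weight \<nu>') = Suc (nat (weight \<mu> - weight \<nu>))"
          using le by auto
        then show ?thesis by (auto simp: f_def)
      qed
      ultimately show ?thesis using T Gb b_eq by simp
    qed
    have "sum f T = (\<Sum>b\<in>T. - f b)"
      by (rule sum.reindex_bij_witness[of _ G G]) (use main in auto)
    then show "sum f T = - sum f T" by (simp add: sum_negf)
  qed
  finally show ?thesis .
qed

lemma eq_of_le_weight:
  assumes "\<And>i. lk \<kappa> i \<le> lk \<mu> i" "weight \<mu> = weight \<kappa>"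
  shows "\<mu> = \<kappa>"
proof (rule poly_mapping_eqI)
  fix i
  have "lk (\<mu> - \<kappa>) i \<le> weight (\<mu> - \<kappa>)"
    using assms(1) by (intro lk_le_weight) (simp add: lookup_minus)
  then show "lk \<mu> i = lk \<kappa> i" using assms by (simp add: weight_diff lookup_minus antisym)
qed

lemma is_partition_0 [simp]: "is_partition 0"
  by (simp add: is_partition_def)

lemma schur_0 [simp]: "schur 0 = 1"
  by (subst schur_eq_partial_schur[of _ 0]) (simp_all add: partial_schur_def pairs_def raise_vec_def)

lemma vstrips_size_0: "is_partition \<kappa> \<Longrightarrow> vstrips \<kappa> 0 = {\<kappa>}"
  by (auto simp: vstrips_def vstrip_def intro: eq_of_le_weight)

text \<open>A vertical strip over the empty shape is a partition with all entries at most 1. This identifies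
the value of \<open>\<omega>\<close> on a generator with a sum over vertical strips.\<close>

lemma vstrips_empty_shape: "vstrips 0 r = {column_part r}"
proof -
  have lk_col: "lk (column_part m) i = (if i < m then 1 else 0)" for m i
    by (simp add: column_part_def lookup_sum_pm lk_unit_vec)
  have wt_col: "weight (column_part m) = int m" for m
  proof (induction m)
    case (Suc m)
    have "column_part (Suc m) = column_part m + unit_vec m" by (simp add: column_part_def)
    then show ?case using Suc by (simp add: weight_add)
  qed (simp add: column_part_def)
  have "\<mu> = column_part r" if \<mu>: "\<mu> \<in> vstrips 0 r" for \<mu>
  proof -
    have p: "is_partition \<mu>" and 01: "0 \<le> lk \<mu> i" "lk \<mu> i \<le> 1" and w: "weight \<mu> = int r" for i
      using \<mu> by (auto simp: vstrips_def vstrip_def)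
    let ?m = "nat (lk (conj_part \<mu>) 0)"
    have "lk \<mu> i = lk (column_part ?m) i" for i
      using less_conj_part_iff[OF p, of i 0] 01[of i] by (auto simp: lk_col)
    then have "\<mu> = column_part ?m" by (rule poly_mapping_eqI)
    then show ?thesis using w wt_col by (metis of_nat_eq_iff)
  qed
  moreover have "column_part r \<in> vstrips 0 r"
    by (auto simp: vstrips_def vstrip_def is_partition_def lk_col wt_col)
  ultimately show ?thesis by blast
qed

text \<open>By \<open>alternating_strips\<close> the sums over vertical strips of size \<open>r\<close> on \<open>\<kappa>\<close> satisfy a
recursion in \<open>r\<close> whose coefficients do not depend on \<open>\<kappa>\<close>. So they are the corresponding
sums for the empty shape multiplied by \<open>U\<^sub>\<kappa>\<close>.\<close>

theorem vertical_pieri: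
  assumes "is_partition \<kappa>"
  shows "schur (column_part r) * schur \<kappa> = (\<Sum>\<mu>\<in>vstrips \<kappa> r. schur \<mu>)"
proof -
  define v where "v \<kappa> r = (\<Sum>\<mu>\<in>vstrips \<kappa> r. schur \<mu>)" for \<kappa> r
  have rec: "v \<kappa> r = - (\<Sum>i=1..r. (- 1) ^ i * (u_gen (int i) * v \<kappa> (r - i)))"
    if "is_partition \<kappa>" "0 < r" for \<kappa> r
  proof -
    have "{..r} = insert 0 {1..r}" by auto
    with alternating_strips[OF that] show ?thesis
      by (simp add: v_def add_eq_0_iff2)
  qed
  have "v \<kappa> r = v 0 r * schur \<kappa>"
  proof (induction r rule: less_induct)
    case (less r)
    show ?case
    proof (cases "r = 0")
      case True
      then show ?thesis using assms by (simp add: v_def vstrips_size_0)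
    next
      case False
      have "v \<kappa> r = - (\<Sum>i=1..r. (- 1) ^ i * (u_gen (int i) * v \<kappa> (r - i)))"
        using rec assms False by blast
      also have "\<dots> = - (\<Sum>i=1..r. (- 1) ^ i * (u_gen (int i) * v 0 (r - i)) * schur \<kappa>)"
        using less False by (intro arg_cong[of _ _ uminus] sum.cong) (auto simp: mult.assoc)
      also have "\<dots> = v 0 r * schur \<kappa>"
        using rec[of 0 r] False by (simp add: sum_distrib_right)
      finally show ?thesis .
    qed
  qed
  then show ?thesis by (simp add: v_def vstrips_empty_shape)
qed

section \<open>Lowest terms and linear independence\<close>

text \<open>Taking the entries of \<open>\<kappa>\<close> as weights controls the inner product of \<open>\<kappa>\<close> with its
raised vector, and taking the positions as weights shows that a nonempty product of raising operators
moves every vector.\<close>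

lemma sum_raise_vec:
  fixes w :: "nat \<Rightarrow> int"
  assumes "S \<subseteq> pairs n"
  shows "(\<Sum>a<n. w a * lk (raise_vec S \<kappa>) a) = (\<Sum>a<n. w a * lk \<kappa> a) + (\<Sum>(i, j)\<in>S. w i - w j)"
proof -
  have "finite S" using assms finite_pairs by (rule finite_subset)
  then show ?thesis using assms
  proof (induction S arbitrary: \<kappa>)
    case empty
    show ?case by (simp add: raise_vec_def)
  next
    case (insert x S)
    obtain i j where x: "x = (i, j)" by (cases x)
    have ij: "i < n" "j < n" using insert.prems by (auto simp: x pairs_def)
    have "(\<Sum>a<n. w a * lk (raise_vec (insert x S) \<kappa>) a)
        = (\<Sum>a<n. w a * lk (raise_vec S (\<kappa> + unit_vec i - unit_vec j)) a)"
      unfolding x by (subst raise_vec_insert) (use insert.hyps in \<open>auto simp: x\<close>)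
    also have "\<dots> = (\<Sum>a<n. w a * lk (\<kappa> + unit_vec i - unit_vec j) a) + (\<Sum>(i, j)\<in>S. w i - w j)"
      using insert by blast
    also have "(\<Sum>a<n. w a * lk (\<kappa> + unit_vec i - unit_vec j) a)
        = (\<Sum>a<n. w a * lk \<kappa> a + (if a = i then w a else 0) - (if a = j then w a else 0))"
      by (intro sum.cong) (auto simp: lookup_add lookup_minus lk_unit_vec algebra_simps)
    also have "\<dots> = (\<Sum>a<n. w a * lk \<kappa> a) + (w i - w j)"
      using ij by (simp add: sum.distrib sum_subtractf)
    finally show ?case using insert.hyps by (simp add: x)
  qed
qed

definition norm_sq :: "int_vec \<Rightarrow> int" where
  "norm_sq \<alpha> = (\<Sum>i\<in>Poly_Mapping.keys \<alpha>. (lk \<alpha> i)\<^sup>2)"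

lemma norm_sq_sum:
  assumes "finite A" "Poly_Mapping.keys \<alpha> \<subseteq> A"
  shows "norm_sq \<alpha> = (\<Sum>i\<in>A. (lk \<alpha> i)\<^sup>2)"
  unfolding norm_sq_def using assms by (intro sum.mono_neutral_left) (auto simp: in_keys_iff)

lemma norm_sq_nonneg: "0 \<le> norm_sq \<alpha>"
  by (simp add: norm_sq_def sum_nonneg)

text \<open>With \<open>\<beta> = \<kappa> + d\<close> one has \<open>|\<beta>|\<^sup>2 = |\<kappa>|\<^sup>2 + 2 \<kappa>\<cdot>d + |d|\<^sup>2\<close>, where \<open>\<kappa>\<cdot>d \<ge> 0\<close>
because the entries of \<open>\<kappa>\<close> decrease, and \<open>d \<noteq> 0\<close> because every raising operator lowers
\<open>\<Sum> a d\<^sub>a\<close>. The norm is preferred to the dominance order since it is invariant under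
permutations, so it is determined by the monomial \<open>u\<^sub>\<beta>\<close> even when \<open>\<beta>\<close> is not sorted.\<close>

lemma norm_sq_raise_vec:
  assumes \<kappa>: "is_partition \<kappa>" "Poly_Mapping.keys \<kappa> \<subseteq> {..<n}" and S: "S \<subseteq> pairs n" "S \<noteq> {}"
  shows "norm_sq \<kappa> < norm_sq (raise_vec S \<kappa>)"
proof -
  define \<beta> where "\<beta> = raise_vec S \<kappa>"
  have fin: "finite S" using S(1) finite_pairs by (rule finite_subset)
  have "lk \<beta> i = 0" if "n \<le> i" for i
    using \<kappa>(2) S(1) that unfolding \<beta>_def keys_bounded_iff
    by (subst lk_raise_vec_same) (auto simp: pairs_def)
  then have \<beta>: "Poly_Mapping.keys \<beta> \<subseteq> {..<n}" unfolding keys_bounded_iff by blast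
  have lt: "i < j" if "(i, j) \<in> S" for i j using S(1) that by (auto simp: pairs_def)
  have "(\<Sum>(i, j)\<in>S. lk \<kappa> i - lk \<kappa> j) \<ge> 0"
    using partition_antimono[OF \<kappa>(1) less_imp_le[OF lt]] by (intro sum_nonneg) auto
  then have 1: "(\<Sum>a<n. lk \<kappa> a * lk \<kappa> a) \<le> (\<Sum>a<n. lk \<kappa> a * lk \<beta> a)"
    unfolding \<beta>_def sum_raise_vec[OF S(1)] by simp
  have "(\<Sum>(i, j)\<in>S. int i - int j) < (\<Sum>(i, j)\<in>S. 0)"
    using S(2) fin lt by (intro sum_strict_mono) auto
  then have "(\<Sum>a<n. int a * lk \<beta> a) \<noteq> (\<Sum>a<n. int a * lk \<kappa> a)"
    unfolding \<beta>_def sum_raise_vec[OF S(1)] by simp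
  then obtain a where a: "a < n" "lk \<beta> a \<noteq> lk \<kappa> a" by (metis (no_types, lifting) lessThan_iff sum.cong)
  have "(\<Sum>a<n. (lk \<beta> a - lk \<kappa> a)\<^sup>2) > 0"
    using a by (intro sum_pos2[of _ a]) auto
  moreover have "(lk \<beta> a - lk \<kappa> a)\<^sup>2 = (lk \<beta> a)\<^sup>2 - 2 * (lk \<kappa> a * lk \<beta> a) + (lk \<kappa> a)\<^sup>2" for a
    by (simp add: power2_eq_square algebra_simps)
  then have "(\<Sum>a<n. (lk \<beta> a - lk \<kappa> a)\<^sup>2)
      = (\<Sum>a<n. (lk \<beta> a)\<^sup>2) - 2 * (\<Sum>a<n. lk \<kappa> a * lk \<beta> a) + (\<Sum>a<n. (lk \<kappa> a)\<^sup>2)"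
    by (simp only: sum.distrib sum_subtractf sum_distrib_left)
  ultimately have "(\<Sum>a<n. (lk \<kappa> a)\<^sup>2) < (\<Sum>a<n. (lk \<beta> a)\<^sup>2)"
    using 1 by (simp add: power2_eq_square)
  then show ?thesis
    using norm_sq_sum[OF _ \<kappa>(2)] norm_sq_sum[OF _ \<beta>] by (simp add: \<beta>_def)
qed

text \<open>The exponent vector of \<open>u\<^sub>\<alpha>\<close> for nonnegative \<open>\<alpha>\<close>; entry \<open>k + 1\<close> of \<open>\<alpha>\<close>
contributes to the variable number \<open>k\<close>.\<close>

definition monom_of :: "int_vec \<Rightarrow> nat \<Rightarrow>\<^sub>0 nat" where
  "monom_of \<alpha> = (\<Sum>i\<in>Poly_Mapping.keys \<alpha>. Poly_Mapping.single (nat (lk \<alpha> i) - 1) 1)"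

text \<open>This reads \<open>norm_sq\<close> off the monomial.\<close>

definition monom_norm_sq :: "(nat \<Rightarrow>\<^sub>0 nat) \<Rightarrow> int" where
  "monom_norm_sq m = (\<Sum>k\<in>Poly_Mapping.keys m. int (Poly_Mapping.lookup m k) * (int k + 1)\<^sup>2)"

lemma u_vec_eq_single:
  assumes "\<And>i. 0 \<le> lk \<alpha> i"
  shows "u_vec \<alpha> = Poly_Mapping.single (monom_of \<alpha>) 1"
proof -
  have "(\<Prod>i\<in>A. u_gen (lk \<alpha> i)) = Poly_Mapping.single (\<Sum>i\<in>A. Poly_Mapping.single (nat (lk \<alpha> i) - 1) 1) 1"
    if "finite A" "A \<subseteq> Poly_Mapping.keys \<alpha>" for A
    using that
  proof (induction A)
    case (insert i A)
    have "lk \<alpha> i > 0" using insert.prems assms[of i] by (auto simp: in_keys_iff)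
    then have "u_gen (lk \<alpha> i) = Poly_Mapping.single (Poly_Mapping.single (nat (lk \<alpha> i) - 1) 1) 1"
      by (simp add: u_gen_def)
    then show ?case using insert by (simp add: mult_single)
  qed simp
  then show ?thesis by (simp add: u_vec_def monom_of_def)
qed

lemma monom_norm_sq_add: "monom_norm_sq (m + m') = monom_norm_sq m + monom_norm_sq m'"
  unfolding monom_norm_sq_def by (rule setsum_keys_plus_distrib) (simp_all add: algebra_simps)

lemma monom_norm_sq_monom_of:
  assumes "\<And>i. 0 \<le> lk \<alpha> i"
  shows "monom_norm_sq (monom_of \<alpha>) = norm_sq \<alpha>"
proof -
  have "monom_norm_sq (\<Sum>i\<in>A. Poly_Mapping.single (nat (lk \<alpha> i) - 1) 1) = (\<Sum>i\<in>A. (lk \<alpha> i)\<^sup>2)"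
    if "finite A" "A \<subseteq> Poly_Mapping.keys \<alpha>" for A
    using that
  proof (induction A)
    case (insert i A)
    have "lk \<alpha> i > 0" using insert.prems assms[of i] by (auto simp: in_keys_iff)
    then have "int (nat (lk \<alpha> i) - 1) + 1 = lk \<alpha> i" by simp
    then have "monom_norm_sq (Poly_Mapping.single (nat (lk \<alpha> i) - 1) 1) = (lk \<alpha> i)\<^sup>2"
      by (simp add: monom_norm_sq_def)
    then show ?case using insert by (simp add: monom_norm_sq_add)
  qed (simp add: monom_norm_sq_def)
  then show ?thesis by (simp add: monom_of_def norm_sq_def)
qed

lemma lookup_u_vec_nonzero:
  assumes "Poly_Mapping.lookup (u_vec \<alpha>) m \<noteq> 0"
  shows "monom_norm_sq m = norm_sq \<alpha>"
proof -
  have "0 \<le> lk \<alpha> i" for i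
    using assms u_vec_neg[of \<alpha> i] by (cases "lk \<alpha> i < 0") auto
  then show ?thesis
    using assms monom_norm_sq_monom_of[of \<alpha>] by (auto simp: u_vec_eq_single lookup_single when_def split: if_splits)
qed

lemma schur_leading_term:
  assumes \<kappa>: "is_partition \<kappa>" and "Poly_Mapping.lookup (schur \<kappa> - u_vec \<kappa>) m \<noteq> 0"
  shows "norm_sq \<kappa> < monom_norm_sq m"
proof -
  obtain n where n: "Poly_Mapping.keys \<kappa> \<subseteq> {..<n}" using keys_bounded by blast
  have "schur \<kappa> = u_vec \<kappa> + (\<Sum>S\<in>Pow (pairs n) - {{}}. (- 1) ^ card S * u_vec (raise_vec S \<kappa>))"
    unfolding schur_eq_partial_schur[OF n] partial_schur_def
    by (subst sum.remove[of _ "{}"]) (auto simp: raise_vec_def)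
  then have "Poly_Mapping.lookup (\<Sum>S\<in>Pow (pairs n) - {{}}. (- 1) ^ card S * u_vec (raise_vec S \<kappa>)) m \<noteq> 0"
    using assms(2) by simp
  then obtain S where S: "S \<in> Pow (pairs n) - {{}}"
    and nz: "Poly_Mapping.lookup ((- 1) ^ card S * u_vec (raise_vec S \<kappa>)) m \<noteq> 0"
    unfolding lookup_sum_pm by (meson sum.neutral)
  have "Poly_Mapping.lookup (u_vec (raise_vec S \<kappa>)) m \<noteq> 0"
    using nz by (cases "even (card S)") auto
  then have "monom_norm_sq m = norm_sq (raise_vec S \<kappa>)" by (rule lookup_u_vec_nonzero)
  moreover have "norm_sq \<kappa> < norm_sq (raise_vec S \<kappa>)"
    using S by (intro norm_sq_raise_vec[OF \<kappa> n]) auto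
  ultimately show ?thesis by simp
qed

lemma lookup_monom_of:
  assumes "\<And>i. 0 \<le> lk \<alpha> i"
  shows "Poly_Mapping.lookup (monom_of \<alpha>) k = card {i. lk \<alpha> i = int k + 1}"
proof -
  have "Poly_Mapping.lookup (monom_of \<alpha>) k
      = (\<Sum>i\<in>Poly_Mapping.keys \<alpha>. if nat (lk \<alpha> i) - 1 = k then 1 else 0)"
    unfolding monom_of_def lookup_sum by (intro sum.cong) (simp_all add: lookup_single when_def)
  also have "\<dots> = card {i \<in> Poly_Mapping.keys \<alpha>. nat (lk \<alpha> i) - 1 = k}"
    by (simp flip: sum.inter_filter)
  also have "{i \<in> Poly_Mapping.keys \<alpha>. nat (lk \<alpha> i) - 1 = k} = {i. lk \<alpha> i = int k + 1}"
  proof -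
    have "lk \<alpha> i \<noteq> 0 \<and> nat (lk \<alpha> i) - 1 = k \<longleftrightarrow> lk \<alpha> i = int k + 1" for i
      using assms[of i] by auto
    then show ?thesis by (simp add: in_keys_iff)
  qed
  finally show ?thesis .
qed

text \<open>The exponents count the parts of each size, and the number of parts of size \<open>k + 1\<close> is the difference
of two consecutive entries of the conjugate partition. As these entries are eventually 0, they are
recovered by downward induction.\<close>

lemma monom_of_inj:
  assumes "is_partition \<kappa>" "is_partition \<mu>" "monom_of \<kappa> = monom_of \<mu>"
  shows "\<kappa> = \<mu>"
proof -
  have diff: "lk (conj_part \<alpha>) k = lk (conj_part \<alpha>) (Suc k) + int (Poly_Mapping.lookup (monom_of \<alpha>) k)"
    if "is_partition \<alpha>" for \<alpha> k
  proof -
    have "finite {i. int k + 1 \<le> lk \<alpha> i}"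
      by (rule finite_subset[OF _ finite_keys[of \<alpha>]]) (auto simp: in_keys_iff)
    moreover have un: "{i. int k + 1 \<le> lk \<alpha> i} = {i. int (Suc k) + 1 \<le> lk \<alpha> i} \<union> {i. lk \<alpha> i = int k + 1}"
      by auto
    ultimately have "card {i. int k + 1 \<le> lk \<alpha> i}
        = card {i. int (Suc k) + 1 \<le> lk \<alpha> i} + card {i. lk \<alpha> i = int k + 1}"
      unfolding un by (subst card_Un_disjoint) auto
    then show ?thesis using that by (simp add: conj_part.rep_eq lookup_monom_of partition_nonneg)
  qed
  obtain n n' where "Poly_Mapping.keys (conj_part \<kappa>) \<subseteq> {..<n'}"
      "Poly_Mapping.keys (conj_part \<mu>) \<subseteq> {..<n}" "n' \<le> n"
    using keys_bounded[of "conj_part \<kappa>"] keys_bounded[of "conj_part \<mu>"] by metis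
  then have zero: "lk (conj_part \<kappa>) i = 0" "lk (conj_part \<mu>) i = 0" if "n \<le> i" for i
    using that unfolding keys_bounded_iff by auto
  have "lk (conj_part \<kappa>) k = lk (conj_part \<mu>) k" for k
  proof (cases "k \<le> n")
    case True
    then show ?thesis
    proof (induction k rule: inc_induct)
      case base
      show ?case by (simp add: zero)
    next
      case (step k)
      then show ?case using diff[OF assms(1), of k] diff[OF assms(2), of k] assms(3) by simp
    qed
  next
    case False
    then show ?thesis by (simp add: zero)
  qed
  then have "conj_part \<kappa> = conj_part \<mu>" by (rule poly_mapping_eqI)
  then show ?thesis using assms by (metis conj_part_conj_part)
qed

lemma frag_cmul_eq: "frag_cmul c (x :: poly_ring) = of_int c * x"
proof -
  have "of_int c * x = Poly_Mapping.map ((*) c) x"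
    by (simp add: mult_map_scale_conv_mult flip: single_of_int)
  then show ?thesis
    by (intro poly_mapping_eqI) (simp add: Poly_Mapping.map.rep_eq when_def)
qed

abbreviation schur_sum :: "(int_vec \<Rightarrow>\<^sub>0 int) \<Rightarrow> poly_ring" where
  "schur_sum \<equiv> frag_extend schur"

text \<open>For an index \<open>\<kappa>\<close> of smallest norm the monomial \<open>u\<^sub>\<kappa>\<close> occurs in no other summand: in
the others it could only be a lowest term, but the lowest terms are distinct.\<close>

lemma schur_sum_lowest_term:
  assumes c: "Poly_Mapping.keys c \<subseteq> Collect is_partition" "c \<noteq> 0"
  shows "\<exists>\<kappa>\<in>Poly_Mapping.keys c. (\<forall>\<mu>\<in>Poly_Mapping.keys c. norm_sq \<kappa> \<le> norm_sq \<mu>)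
    \<and> Poly_Mapping.lookup (schur_sum c) (monom_of \<kappa>) \<noteq> 0"
proof -
  have "\<exists>\<kappa>\<in>Poly_Mapping.keys c. \<forall>\<mu>\<in>Poly_Mapping.keys c. norm_sq \<kappa> \<le> norm_sq \<mu>"
    using c(2) by (metis arg_min_if_finite(1) arg_min_least finite_keys keys_eq_empty)
  then obtain \<kappa> where \<kappa>: "\<kappa> \<in> Poly_Mapping.keys c" and min: "\<And>\<mu>. \<mu> \<in> Poly_Mapping.keys c \<Longrightarrow> norm_sq \<kappa> \<le> norm_sq \<mu>"
    by blast
  have p: "is_partition \<mu>" if "\<mu> \<in> Poly_Mapping.keys c" for \<mu> using c(1) that by blast
  have coeff: "Poly_Mapping.lookup (schur \<mu>) (monom_of \<kappa>) = (if \<mu> = \<kappa> then 1 else 0)"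
    if \<mu>: "\<mu> \<in> Poly_Mapping.keys c" for \<mu>
  proof -
    have "monom_norm_sq (monom_of \<kappa>) \<le> norm_sq \<mu>"
      using min[OF \<mu>] p[OF \<kappa>] by (simp add: monom_norm_sq_monom_of partition_nonneg)
    then have "Poly_Mapping.lookup (schur \<mu> - u_vec \<mu>) (monom_of \<kappa>) = 0"
      using schur_leading_term[OF p[OF \<mu>]] by force
    then show ?thesis
      using monom_of_inj[OF p[OF \<mu>] p[OF \<kappa>]] p[OF \<mu>]
      by (auto simp: lookup_minus u_vec_eq_single partition_nonneg lookup_single when_def)
  qed
  have "Poly_Mapping.lookup (schur_sum c) (monom_of \<kappa>)
      = (\<Sum>\<mu>\<in>Poly_Mapping.keys c. Poly_Mapping.lookup c \<mu> * Poly_Mapping.lookup (schur \<mu>) (monom_of \<kappa>))"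
    by (simp add: frag_extend_def lookup_sum_pm)
  also have "\<dots> = (\<Sum>\<mu>\<in>Poly_Mapping.keys c. if \<mu> = \<kappa> then Poly_Mapping.lookup c \<mu> else 0)"
    by (intro sum.cong) (auto simp: coeff)
  also have "\<dots> \<noteq> 0" using \<kappa> by (simp add: in_keys_iff)
  finally show ?thesis using \<kappa> min by blast
qed

lemma schur_sum_inj:
  assumes "Poly_Mapping.keys c \<subseteq> Collect is_partition" "Poly_Mapping.keys d \<subseteq> Collect is_partition"
    and "schur_sum c = schur_sum d"
  shows "c = d"
proof (rule ccontr)
  assume "c \<noteq> d"
  moreover have "Poly_Mapping.keys (c - d) \<subseteq> Collect is_partition"
    using order_trans[OF keys_diff] assms(1,2) by (metis Un_least)
  ultimately have "schur_sum (c - d) \<noteq> 0"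
    using schur_sum_lowest_term[of "c - d"] by (metis lookup_zero right_minus_eq)
  then show False using assms by (simp add: frag_extend_diff)
qed

section \<open>The ring homomorphism omega and the Schur basis\<close>

lemma u_gen_Suc: "u_gen (int (Suc k)) = Poly_Mapping.single (Poly_Mapping.single k 1) 1"
  by (simp add: u_gen_def nat_add_distrib)

lemma poly_ring_induct [case_names one gen diff]:
  assumes one: "P (1 :: poly_ring)"
    and gen: "\<And>r f. 1 \<le> r \<Longrightarrow> P f \<Longrightarrow> P (u_gen (int r) * f)"
    and diff: "\<And>f g. P f \<Longrightarrow> P g \<Longrightarrow> P (f - g)"
  shows "P f"
proof -
  have monom: "P (Poly_Mapping.single m 1)" for m
  proof (induction m rule: update_induct)
    case const
    show ?case using one by simp
  next
    case (update m k v)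
    have "P (Poly_Mapping.single (m + Poly_Mapping.single k v) 1)"
    proof (induction v)
      case 0
      show ?case using update by simp
    next
      case (Suc v)
      have "m + Poly_Mapping.single k (Suc v) = Poly_Mapping.single k 1 + (m + Poly_Mapping.single k v)"
        by (rule poly_mapping_eqI) (simp add: lookup_add lookup_single when_def)
      then have "Poly_Mapping.single (m + Poly_Mapping.single k (Suc v)) (1::int)
          = u_gen (int (Suc k)) * Poly_Mapping.single (m + Poly_Mapping.single k v) 1"
        unfolding u_gen_Suc by (simp add: mult_single)
      then show ?case using gen[OF _ Suc, of "Suc k"] by simp
    qed
    moreover have "Poly_Mapping.update k v m = m + Poly_Mapping.single k v"
      using update by (intro poly_mapping_eqI) (auto simp: lookup_update lookup_add lookup_single when_def in_keys_iff)
    ultimately show ?case by simp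
  qed
  show ?thesis
    using subset_UNIV[of "Poly_Mapping.keys f"]
  proof (induction f rule: frag_induction)
    case zero
    show ?case using diff[OF one one] by simp
  qed (use monom diff in auto)
qed

lemma is_ring_hom_diff:
  assumes "is_ring_hom w"
  shows "w (f - g) = w f - w g"
proof -
  have "w f = w (f - g) + w g" using assms unfolding is_ring_hom_def by (metis diff_add_cancel)
  then show ?thesis by simp
qed

lemma ex1_ring_hom: "\<exists>!w. is_ring_hom w \<and> (\<forall>r\<ge>1. w (u_gen (int r)) = g r)"
  for g :: "nat \<Rightarrow> poly_ring"
proof (rule ex_ex1I)
  define h where "h m = (\<Prod>k\<in>Poly_Mapping.keys m. g (Suc k) ^ Poly_Mapping.lookup m k)" for m :: "nat \<Rightarrow>\<^sub>0 nat"
  define w where "w = frag_extend h"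
  have h_eq: "h m = (\<Prod>k\<in>A. g (Suc k) ^ Poly_Mapping.lookup m k)" if "finite A" "Poly_Mapping.keys m \<subseteq> A" for m A
    unfolding h_def using that by (intro prod.mono_neutral_left) (auto simp: in_keys_iff)
  have h_add: "h (m + m') = h m * h m'" for m m'
  proof -
    let ?A = "Poly_Mapping.keys m \<union> Poly_Mapping.keys m'"
    have "h a = (\<Prod>k\<in>?A. g (Suc k) ^ Poly_Mapping.lookup a k)" if "a \<in> {m, m', m + m'}" for a
      using that keys_add[of m m'] by (intro h_eq) auto
    then show ?thesis by (simp add: lookup_add power_add prod.distrib)
  qed
  have single: "w (frag_of m) = h m" for m by (simp add: w_def)
  have w_diff: "w (x - y) = w x - w y" for x y by (simp add: w_def frag_extend_diff)
  have mono: "w (frag_of m * y) = h m * w y" for m y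
    using subset_UNIV[of "Poly_Mapping.keys y"]
  proof (induction y rule: frag_induction)
    case zero
    show ?case by (simp add: w_def)
  next
    case (one m')
    show ?case by (simp add: mult_single single h_add)
  next
    case (diff a b)
    then show ?case by (simp add: right_diff_distrib w_diff)
  qed
  have "w (x * y) = w x * w y" for x y
    using subset_UNIV[of "Poly_Mapping.keys x"]
  proof (induction x rule: frag_induction)
    case zero
    show ?case by (simp add: w_def)
  next
    case (one m')
    show ?case by (simp add: mono single)
  next
    case (diff a b)
    then show ?case by (simp add: left_diff_distrib w_diff)
  qed
  moreover have "w 1 = 1" using single[of 0] by (simp add: h_def)
  ultimately have "is_ring_hom w" by (simp add: is_ring_hom_def w_def frag_extend_add)
  moreover have "w (u_gen (int r)) = g r" if r1: "1 \<le> r" for r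
  proof -
    obtain k where r: "r = Suc k" using r1 by (cases r) auto
    show ?thesis unfolding r u_gen_Suc single by (simp add: h_def)
  qed
  ultimately show "\<exists>w. is_ring_hom w \<and> (\<forall>r\<ge>1. w (u_gen (int r)) = g r)" by blast
next
  fix w w' assume w: "is_ring_hom w \<and> (\<forall>r\<ge>1. w (u_gen (int r)) = g r)"
    and w': "is_ring_hom w' \<and> (\<forall>r\<ge>1. w' (u_gen (int r)) = g r)"
  show "w = w'"
  proof
    fix f show "w f = w' f"
    proof (induction f rule: poly_ring_induct)
      case (diff f g)
      then show ?case using w w' by (simp add: is_ring_hom_diff)
    qed (use w w' in \<open>auto simp: is_ring_hom_def\<close>)
  qed
qed

lemma omega_hom:
  shows omega_ring_hom: "is_ring_hom omega_hom"
    and omega_u_gen: "omega_hom (u_gen (int r)) = schur (column_part r)"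
proof -
  have *: "is_ring_hom omega_hom \<and> (\<forall>r\<ge>1. omega_hom (u_gen (int r)) = schur (column_part r))"
    unfolding omega_hom_def by (rule theI'[OF ex1_ring_hom])
  then show "is_ring_hom omega_hom" by blast
  show "omega_hom (u_gen (int r)) = schur (column_part r)"
  proof (cases "1 \<le> r")
    case False
    then have "r = 0" by simp
    then show ?thesis using * by (simp add: is_ring_hom_def column_part_def)
  qed (use * in blast)
qed

text \<open>Both Pieri rules at once. The same coefficients \<open>d\<close> describe multiplication by \<open>u\<^sub>p\<close> in terms of the
\<open>U\<^sub>\<kappa>\<close> and multiplication by \<open>\<omega>(u\<^sub>p)\<close> in terms of the conjugate \<open>U\<^sub>\<kappa>\<close>.\<close>

lemma pieri_schur_sum:
  fixes p :: nat
  assumes "Poly_Mapping.keys c \<subseteq> Collect is_partition"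
  defines "d \<equiv> frag_extend (\<lambda>\<kappa>. \<Sum>\<mu>\<in>hstrips \<kappa> p. frag_of \<mu>) c"
  shows "Poly_Mapping.keys d \<subseteq> (\<Union>\<kappa>\<in>Poly_Mapping.keys c. hstrips \<kappa> p)"
    and "u_gen (int p) * schur_sum c = schur_sum d"
    and "schur (column_part p) * frag_extend (schur \<circ> conj_part) c = frag_extend (schur \<circ> conj_part) d"
proof -
  have "Poly_Mapping.keys (\<Sum>\<mu>\<in>hstrips \<kappa> p. frag_of \<mu>) \<subseteq> hstrips \<kappa> p" for \<kappa>
    using keys_sum[of frag_of "hstrips \<kappa> p"] by auto
  then show "Poly_Mapping.keys d \<subseteq> (\<Union>\<kappa>\<in>Poly_Mapping.keys c. hstrips \<kappa> p)"
    unfolding d_def by (intro order_trans[OF keys_frag_extend] UN_mono) auto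
  have "u_gen (int p) * schur_sum c = schur_sum d \<and>
     schur (column_part p) * frag_extend (schur \<circ> conj_part) c = frag_extend (schur \<circ> conj_part) d"
    unfolding d_def using assms(1)
  proof (induction c rule: frag_induction)
    case zero
    show ?case by simp
  next
    case (one \<kappa>)
    then have \<kappa>: "is_partition \<kappa>" by simp
    have fin: "finite (hstrips \<kappa> p)" by (rule finite_hstrips[OF \<kappa>])
    have "inj_on conj_part (hstrips \<kappa> p)"
      using hstrip_partition[OF \<kappa>] conj_part_conj_part unfolding hstrips_def by (metis (mono_tags, lifting) inj_onI mem_Collect_eq)
    then have "schur (column_part p) * schur (conj_part \<kappa>) = (\<Sum>\<mu>\<in>hstrips \<kappa> p. schur (conj_part \<mu>))"
      using vertical_pieri[OF is_partition_conj_part[OF \<kappa>], of p]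
      by (simp add: vstrips_conj_part[OF \<kappa>] sum.reindex)
    then show ?case using \<kappa> fin by (simp add: pieri frag_extend_sum)
  next
    case (diff a b)
    then show ?case by (simp add: frag_extend_diff right_diff_distrib)
  qed
  then show "u_gen (int p) * schur_sum c = schur_sum d"
    and "schur (column_part p) * frag_extend (schur \<circ> conj_part) c = frag_extend (schur \<circ> conj_part) d"
    by blast+
qed

lemma hstrips_partition: "is_partition \<kappa> \<Longrightarrow> \<mu> \<in> hstrips \<kappa> p \<Longrightarrow> is_partition \<mu>"
  unfolding hstrips_def using hstrip_partition by blast

text \<open>The Schur polynomials span. That \<open>\<omega>\<close> conjugates the expansion is carried along in the induction,
since \<open>\<omega>(U\<^sub>\<kappa>)\<close> is not accessible directly: only products of generators have known images.\<close>

lemma schur_expansion: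
  "\<exists>c. Poly_Mapping.keys c \<subseteq> Collect is_partition \<and> f = schur_sum c
     \<and> omega_hom f = frag_extend (schur \<circ> conj_part) c"
proof (induction f rule: poly_ring_induct)
  case one
  have "conj_part 0 = 0" by (rule poly_mapping_eqI) (simp add: conj_part.rep_eq)
  then show ?case
    using omega_ring_hom frag_extend_of[of schur 0] frag_extend_of[of "schur \<circ> conj_part" 0]
    by (intro exI[of _ "frag_of 0"]) (simp add: is_ring_hom_def comp_def)
next
  case (gen r f)
  then obtain c where c: "Poly_Mapping.keys c \<subseteq> Collect is_partition" "f = schur_sum c"
    "omega_hom f = frag_extend (schur \<circ> conj_part) c" by blast
  let ?d = "frag_extend (\<lambda>\<kappa>. \<Sum>\<mu>\<in>hstrips \<kappa> r. frag_of \<mu>) c"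
  have "Poly_Mapping.keys ?d \<subseteq> Collect is_partition"
    using pieri_schur_sum(1)[OF c(1), of r] c(1) hstrips_partition by blast
  moreover have "omega_hom (u_gen (int r) * f) = schur (column_part r) * omega_hom f"
    using omega_ring_hom omega_u_gen by (simp add: is_ring_hom_def)
  ultimately show ?case
    using pieri_schur_sum(2,3)[OF c(1), of r] c by (intro exI[of _ ?d]) (simp add: comp_def)
next
  case (diff f g)
  then obtain c d where "Poly_Mapping.keys c \<subseteq> Collect is_partition" "f = schur_sum c"
    "omega_hom f = frag_extend (schur \<circ> conj_part) c"
    "Poly_Mapping.keys d \<subseteq> Collect is_partition" "g = schur_sum d"
    "omega_hom g = frag_extend (schur \<circ> conj_part) d" by blast
  moreover from this have "Poly_Mapping.keys (c - d) \<subseteq> Collect is_partition"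
    by (intro order_trans[OF keys_diff]) simp
  ultimately show ?case
    by (intro exI[of _ "c - d"]) (simp add: comp_def frag_extend_diff is_ring_hom_diff[OF omega_ring_hom])
qed

definition schur_coeffs :: "poly_ring \<Rightarrow> int_vec \<Rightarrow>\<^sub>0 int" where
  "schur_coeffs f = (THE c. Poly_Mapping.keys c \<subseteq> Collect is_partition \<and> f = schur_sum c)"

lemma schur_coeffs_unique:
  assumes "Poly_Mapping.keys c \<subseteq> Collect is_partition" "f = schur_sum c"
  shows "schur_coeffs f = c"
  unfolding schur_coeffs_def 
proof (rule the_equality)
  fix d assume "Poly_Mapping.keys d \<subseteq> Collect is_partition \<and> f = schur_sum d"
  then show "d = c" using assms by (intro schur_sum_inj) simp_all
qed (use assms in blast)

lemma schur_coeffs: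
  shows keys_schur_coeffs: "Poly_Mapping.keys (schur_coeffs f) \<subseteq> Collect is_partition"
    and schur_sum_schur_coeffs: "schur_sum (schur_coeffs f) = f"
    and omega_schur_coeffs: "omega_hom f = frag_extend (schur \<circ> conj_part) (schur_coeffs f)"
proof -
  obtain c where c: "Poly_Mapping.keys c \<subseteq> Collect is_partition" "f = schur_sum c"
    "omega_hom f = frag_extend (schur \<circ> conj_part) c" using schur_expansion[of f] by blast
  have "schur_coeffs f = c" using c(1,2) by (rule schur_coeffs_unique)
  with c show "Poly_Mapping.keys (schur_coeffs f) \<subseteq> Collect is_partition"
    "schur_sum (schur_coeffs f) = f" "omega_hom f = frag_extend (schur \<circ> conj_part) (schur_coeffs f)"
    by simp_all
qed

lemma schur_coeffs_add: "schur_coeffs (f + g) = schur_coeffs f + schur_coeffs g"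
proof (rule schur_coeffs_unique)
  show "Poly_Mapping.keys (schur_coeffs f + schur_coeffs g) \<subseteq> Collect is_partition"
    using keys_schur_coeffs by (intro order_trans[OF keys_add]) simp
qed (simp add: frag_extend_add schur_sum_schur_coeffs)

lemma schur_coeffs_of_int_mult: "schur_coeffs (of_int k * f) = frag_cmul k (schur_coeffs f)"
proof (rule schur_coeffs_unique)
  show "Poly_Mapping.keys (frag_cmul k (schur_coeffs f)) \<subseteq> Collect is_partition"
    using keys_schur_coeffs by (rule order_trans[OF keys_cmul])
  show "of_int k * f = schur_sum (frag_cmul k (schur_coeffs f))"
    by (simp only: frag_extend_cmul schur_sum_schur_coeffs frag_cmul_eq)
qed

lemma schur_coeffs_sum: "finite A \<Longrightarrow> schur_coeffs (\<Sum>x\<in>A. f x) = (\<Sum>x\<in>A. schur_coeffs (f x))"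
  by (induction A rule: finite_induct)
     (auto simp: schur_coeffs_add intro: schur_coeffs_unique)

lemma omega_schur:
  assumes "is_partition \<kappa>"
  shows "omega_hom (schur \<kappa>) = schur (conj_part \<kappa>)"
proof -
  have "schur_coeffs (schur \<kappa>) = frag_of \<kappa>"
    using assms by (intro schur_coeffs_unique) auto
  then show ?thesis using omega_schur_coeffs[of "schur \<kappa>"] by simp
qed

text \<open>Taken with multiplicativity of \<open>\<omega>\<close>, this is the conjugation symmetry of the structure constants
of the Schur basis.\<close>

lemma schur_coeffs_omega:
  assumes "is_partition \<kappa>"
  shows "Poly_Mapping.lookup (schur_coeffs (omega_hom f)) (conj_part \<kappa>) = Poly_Mapping.lookup (schur_coeffs f) \<kappa>"
proof -
  define c where "c = schur_coeffs f"
  have c: "Poly_Mapping.keys c \<subseteq> Collect is_partition" by (simp add: c_def keys_schur_coeffs)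
  let ?d = "frag_extend (frag_of \<circ> conj_part) c"
  have "Poly_Mapping.keys ?d \<subseteq> Collect is_partition"
    using keys_frag_extend[of "frag_of \<circ> conj_part" c] c is_partition_conj_part by fastforce
  then have "schur_coeffs (omega_hom f) = ?d"
    by (rule schur_coeffs_unique) (simp add: frag_extend_compose omega_schur_coeffs[of f] c_def)
  then have "Poly_Mapping.lookup (schur_coeffs (omega_hom f)) (conj_part \<kappa>)
      = (\<Sum>\<mu>\<in>Poly_Mapping.keys c. Poly_Mapping.lookup c \<mu> * Poly_Mapping.lookup (frag_of (conj_part \<mu>)) (conj_part \<kappa>))"
    by (simp add: frag_extend_def lookup_sum_pm del: lookup_frag_of)
  also have "\<dots> = (\<Sum>\<mu>\<in>Poly_Mapping.keys c. if \<mu> = \<kappa> then Poly_Mapping.lookup c \<mu> else 0)"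
  proof (rule sum.cong[OF refl])
    fix \<mu> assume "\<mu> \<in> Poly_Mapping.keys c"
    then have "is_partition \<mu>" using c by blast
    then have "conj_part \<kappa> = conj_part \<mu> \<longleftrightarrow> \<mu> = \<kappa>" using assms conj_part_conj_part by metis
    then show "Poly_Mapping.lookup c \<mu> * Poly_Mapping.lookup (frag_of (conj_part \<mu>)) (conj_part \<kappa>)
      = (if \<mu> = \<kappa> then Poly_Mapping.lookup c \<mu> else 0)"
      by simp
  qed
  also have "\<dots> = Poly_Mapping.lookup c \<kappa>" by (auto simp: in_keys_iff)
  finally show ?thesis by (simp add: c_def)
qed

section \<open>Kostka numbers and skew Schur polynomials\<close>

lemma u_vec_mult_schur:
  assumes \<alpha>: "is_partition \<alpha>" and \<mu>: "is_partition \<mu>"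
  shows "Poly_Mapping.keys (schur_coeffs (u_vec \<alpha> * schur \<mu>))
    \<subseteq> {\<kappa>. is_partition \<kappa> \<and> young_le \<mu> \<kappa> \<and> weight \<kappa> = weight \<mu> + weight \<alpha>}"
proof -
  have "\<exists>c. Poly_Mapping.keys c \<subseteq> {\<kappa>. is_partition \<kappa> \<and> young_le \<mu> \<kappa> \<and> weight \<kappa> = weight \<mu> + (\<Sum>i\<in>A. lk \<alpha> i)}
      \<and> (\<Prod>i\<in>A. u_gen (lk \<alpha> i)) * schur \<mu> = schur_sum c" if "finite A" for A
    using that
  proof (induction A)
    case empty
    show ?case using \<mu> by (intro exI[of _ "frag_of \<mu>"]) (simp add: young_le_def)
  next
    case (insert i A)
    then obtain c where c: "Poly_Mapping.keys c \<subseteq> {\<kappa>. is_partition \<kappa> \<and> young_le \<mu> \<kappa> \<and> weight \<kappa> = weight \<mu> + (\<Sum>i\<in>A. lk \<alpha> i)}"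
      "(\<Prod>i\<in>A. u_gen (lk \<alpha> i)) * schur \<mu> = schur_sum c" by blast
    define p where "p = nat (lk \<alpha> i)"
    have p: "lk \<alpha> i = int p" using partition_nonneg[OF \<alpha>] by (simp add: p_def)
    have c_p: "Poly_Mapping.keys c \<subseteq> Collect is_partition" using c(1) by blast
    let ?d = "frag_extend (\<lambda>\<kappa>. \<Sum>\<mu>\<in>hstrips \<kappa> p. frag_of \<mu>) c"
    have "is_partition \<nu> \<and> young_le \<mu> \<nu> \<and> weight \<nu> = weight \<mu> + (\<Sum>i\<in>insert i A. lk \<alpha> i)"
      if \<nu>: "\<nu> \<in> Poly_Mapping.keys ?d" for \<nu>
    proof -
      obtain \<kappa> where \<kappa>: "\<kappa> \<in> Poly_Mapping.keys c" "\<nu> \<in> hstrips \<kappa> p"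
        using pieri_schur_sum(1)[OF c_p, of p] \<nu> by blast
      have le: "lk \<mu> i \<le> lk \<kappa> i" "lk \<kappa> i \<le> lk \<nu> i" for i
        using \<kappa> c(1) by (auto simp: young_le_def hstrips_def hstrip_def)
      have "young_le \<mu> \<nu>" unfolding young_le_def using order_trans[OF le] by blast
      then show ?thesis
        using \<kappa> c(1) hstrips_partition[of \<kappa> \<nu> p] insert.hyps p by (auto simp: hstrips_def)
    qed
    moreover have "(\<Prod>i\<in>insert i A. u_gen (lk \<alpha> i)) * schur \<mu> = schur_sum ?d"
      using insert.hyps c(2) p pieri_schur_sum(2)[OF c_p, of p] by (simp add: mult.assoc)
    ultimately show ?case by (intro exI[of _ ?d]) blast
  qed
  from this[of "Poly_Mapping.keys \<alpha>"]
  obtain c where c: "Poly_Mapping.keys c \<subseteq> {\<kappa>. is_partition \<kappa> \<and> young_le \<mu> \<kappa> \<and> weight \<kappa> = weight \<mu> + weight \<alpha>}"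
      "u_vec \<alpha> * schur \<mu> = schur_sum c"
    by (auto simp: weight_def u_vec_def)
  then have "schur_coeffs (u_vec \<alpha> * schur \<mu>) = c" by (intro schur_coeffs_unique) auto
  then show ?thesis using c(1) by simp
qed

lemma kostka_eq:
  assumes "is_partition \<alpha>" "is_partition \<mu>"
  shows "kostka \<kappa> \<mu> \<alpha> = Poly_Mapping.lookup (schur_coeffs (u_vec \<alpha> * schur \<mu>)) \<kappa>"
proof -
  have "kostka_coeffs \<mu> \<alpha> = schur_coeffs (u_vec \<alpha> * schur \<mu>)"
    unfolding kostka_coeffs_def
  proof (rule the_equality)
    show "(\<forall>lam\<in>Poly_Mapping.keys (schur_coeffs (u_vec \<alpha> * schur \<mu>)). is_partition lam \<and> young_le \<mu> lam) \<and>
      u_vec \<alpha> * schur \<mu> = (\<Sum>lam\<in>Poly_Mapping.keys (schur_coeffs (u_vec \<alpha> * schur \<mu>)).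
        of_int (Poly_Mapping.lookup (schur_coeffs (u_vec \<alpha> * schur \<mu>)) lam) * schur lam)"
      using u_vec_mult_schur[OF assms] schur_sum_schur_coeffs[of "u_vec \<alpha> * schur \<mu>"]
      by (auto simp: frag_extend_def frag_cmul_eq)
  next
    fix c
    assume "(\<forall>lam\<in>Poly_Mapping.keys c. is_partition lam \<and> young_le \<mu> lam) \<and>
      u_vec \<alpha> * schur \<mu> = (\<Sum>lam\<in>Poly_Mapping.keys c. of_int (Poly_Mapping.lookup c lam) * schur lam)"
    then show "c = schur_coeffs (u_vec \<alpha> * schur \<mu>)"
      by (intro schur_coeffs_unique[symmetric]) (auto simp: frag_extend_def frag_cmul_eq)
  qed
  then show ?thesis by (simp add: kostka_def)
qed

lemma kostka_nonzero:
  assumes "is_partition \<alpha>" "is_partition \<mu>" "kostka \<kappa> \<mu> \<alpha> \<noteq> 0"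
  shows "weight \<kappa> = weight \<mu> + weight \<alpha>"
proof -
  have "\<kappa> \<in> Poly_Mapping.keys (schur_coeffs (u_vec \<alpha> * schur \<mu>))"
    using assms by (simp add: kostka_eq in_keys_iff)
  then show ?thesis using u_vec_mult_schur[OF assms(1,2)] by blast
qed

text \<open>The difference of \<open>u\<^sub>\<alpha>\<close> and \<open>U\<^sub>\<alpha>\<close> involves only monomials of norm larger than that of
\<open>\<alpha>\<close>, and the lowest term of its Schur expansion is one of these monomials.\<close>

lemma kostka_unitriangular:
  assumes \<alpha>: "is_partition \<alpha>"
  shows "kostka \<alpha> 0 \<alpha> = 1" and "kostka \<kappa> 0 \<alpha> \<noteq> 0 \<Longrightarrow> \<kappa> = \<alpha> \<or> norm_sq \<alpha> < norm_sq \<kappa>"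
proof -
  define c where "c = schur_coeffs (u_vec \<alpha>) - frag_of \<alpha>"
  have c: "Poly_Mapping.keys c \<subseteq> Collect is_partition"
    unfolding c_def using keys_diff[of "schur_coeffs (u_vec \<alpha>)" "frag_of \<alpha>"] keys_schur_coeffs[of "u_vec \<alpha>"] \<alpha>
    by auto
  have sum_c: "schur_sum c = - (schur \<alpha> - u_vec \<alpha>)"
    by (simp add: c_def frag_extend_diff schur_sum_schur_coeffs)
  have *: "norm_sq \<alpha> < norm_sq \<kappa>" if "\<kappa> \<in> Poly_Mapping.keys c" for \<kappa>
  proof -
    have "c \<noteq> 0" using that by auto
    then obtain \<mu> where \<mu>: "\<mu> \<in> Poly_Mapping.keys c" "\<forall>\<nu>\<in>Poly_Mapping.keys c. norm_sq \<mu> \<le> norm_sq \<nu>"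
      "Poly_Mapping.lookup (schur_sum c) (monom_of \<mu>) \<noteq> 0"
      using schur_sum_lowest_term[OF c] by blast
    have "norm_sq \<alpha> < monom_norm_sq (monom_of \<mu>)"
      using \<mu>(3) unfolding sum_c by (intro schur_leading_term[OF \<alpha>]) (simp add: lookup_minus)
    also have "\<dots> = norm_sq \<mu>" using \<mu>(1) c by (intro monom_norm_sq_monom_of partition_nonneg) auto
    also have "\<dots> \<le> norm_sq \<kappa>" using \<mu>(2) that by blast
    finally show ?thesis .
  qed
  have K: "kostka \<kappa> 0 \<alpha> = Poly_Mapping.lookup c \<kappa> + (if \<kappa> = \<alpha> then 1 else 0)" for \<kappa>
    using \<alpha> by (simp add: kostka_eq c_def lookup_minus)
  show "kostka \<alpha> 0 \<alpha> = 1" using *[of \<alpha>] by (auto simp: K in_keys_iff)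
  show "\<kappa> = \<alpha> \<or> norm_sq \<alpha> < norm_sq \<kappa>" if "kostka \<kappa> 0 \<alpha> \<noteq> 0"
    using that *[of \<kappa>] by (auto simp: K in_keys_iff split: if_splits)
qed

text \<open>Back substitution along \<open>q\<close>, which shows that the \<open>t\<^sub>\<nu>\<close> are well defined.\<close>

lemma unitriangular_system_unique_solution:
  fixes K :: "'a \<Rightarrow> 'a \<Rightarrow> int" and q :: "'a \<Rightarrow> nat" and y :: "'a \<Rightarrow> 'b :: ring_1"
  assumes fin: "\<And>x. P x \<Longrightarrow> finite {b. P b \<and> K x b \<noteq> 0}"
    and diag: "\<And>x. P x \<Longrightarrow> K x x = 1"
    and tri: "\<And>x b. P x \<Longrightarrow> P b \<Longrightarrow> K x b \<noteq> 0 \<Longrightarrow> b = x \<or> q b < q x"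
  shows "\<exists>!t. (\<forall>x. \<not> P x \<longrightarrow> t x = 0) \<and> (\<forall>x. P x \<longrightarrow> y x = (\<Sum>b | P b \<and> K x b \<noteq> 0. of_int (K x b) * t b))"
proof -
  let ?B = "\<lambda>x. {b. P b \<and> K x b \<noteq> 0} - {x}"
  have split: "(\<Sum>b | P b \<and> K x b \<noteq> 0. of_int (K x b) * t b) = t x + (\<Sum>b\<in>?B x. of_int (K x b) * t b)"
    if "P x" for t :: "'a \<Rightarrow> 'b" and x
    using sum.remove[OF fin[OF that], of x "\<lambda>b. of_int (K x b) * t b"] diag[OF that] that by simp
  show ?thesis
  proof (rule ex_ex1I)
    define H where "H = (\<lambda>t x. if P x then y x - (\<Sum>b\<in>?B x. of_int (K x b) * t b) else 0)"
    define t where "t = wfrec (measure q) H"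
    have t: "t x = H (cut t (measure q) x) x" for x
      unfolding t_def by (rule wfrec) simp
    have "y x = (\<Sum>b | P b \<and> K x b \<noteq> 0. of_int (K x b) * t b)" if x: "P x" for x
    proof -
      have "cut t (measure q) x b = t b" if "b \<in> ?B x" for b
        using tri[OF x, of b] that by (intro cut_apply) auto
      then have "t x = y x - (\<Sum>b\<in>?B x. of_int (K x b) * t b)"
        using x by (subst t) (simp add: H_def)
      then show ?thesis unfolding split[OF x] by simp
    qed
    moreover have "t x = 0" if "\<not> P x" for x using that by (subst t) (simp add: H_def)
    ultimately show "\<exists>t. (\<forall>x. \<not> P x \<longrightarrow> t x = 0) \<and> (\<forall>x. P x \<longrightarrow> y x = (\<Sum>b | P b \<and> K x b \<noteq> 0. of_int (K x b) * t b))"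
      by blast
  next
    fix t t' :: "'a \<Rightarrow> 'b"
    assume t: "(\<forall>x. \<not> P x \<longrightarrow> t x = 0) \<and> (\<forall>x. P x \<longrightarrow> y x = (\<Sum>b | P b \<and> K x b \<noteq> 0. of_int (K x b) * t b))"
      and t': "(\<forall>x. \<not> P x \<longrightarrow> t' x = 0) \<and> (\<forall>x. P x \<longrightarrow> y x = (\<Sum>b | P b \<and> K x b \<noteq> 0. of_int (K x b) * t' b))"
    have "t x = t' x" for x
    proof (induction "q x" arbitrary: x rule: less_induct)
      case less
      show ?case
      proof (cases "P x")
        case True
        have "t b = t' b" if "b \<in> ?B x" for b using tri[OF True, of b] less that by auto
        then have "(\<Sum>b\<in>?B x. of_int (K x b) * t b) = (\<Sum>b\<in>?B x. of_int (K x b) * t' b)" by simp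
        moreover have "t x + (\<Sum>b\<in>?B x. of_int (K x b) * t b) = t' x + (\<Sum>b\<in>?B x. of_int (K x b) * t' b)"
          using conjunct2[OF t, rule_format, OF True] conjunct2[OF t', rule_format, OF True]
          unfolding split[OF True] by simp
        ultimately show ?thesis by simp
      next
        case False
        then have "t x = 0" "t' x = 0" using conjunct1[OF t] conjunct1[OF t'] by blast+
        then show ?thesis by simp
      qed
    qed
    then show "t = t'" by blast
  qed
qed

lemma schur_eq_t_basis:
  assumes "is_partition \<kappa>"
  shows "schur \<kappa> = (\<Sum>\<nu>\<in>partitions (weight \<kappa>). of_int (kostka \<kappa> 0 \<nu>) * t_basis \<nu>)"
proof -
  have sub: "{\<nu>. is_partition \<nu> \<and> kostka \<kappa> 0 \<nu> \<noteq> 0} \<subseteq> partitions (weight \<kappa>)" for \<kappa>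
    using kostka_nonzero[of _ 0 \<kappa>] by (auto simp: partitions_def)
  have "\<exists>!t. (\<forall>mu. \<not> is_partition mu \<longrightarrow> t mu = 0) \<and> (\<forall>lam. is_partition lam \<longrightarrow>
      schur lam = (\<Sum>mu | is_partition mu \<and> kostka lam 0 mu \<noteq> 0. of_int (kostka lam 0 mu) * t mu))"
  proof (rule unitriangular_system_unique_solution[where q = "nat \<circ> norm_sq"])
    show "finite {b. is_partition b \<and> kostka x 0 b \<noteq> 0}" for x
      by (rule finite_subset[OF sub]) simp
    show "kostka x 0 x = 1" if "is_partition x" for x using that by (rule kostka_unitriangular)
    show "b = x \<or> (nat \<circ> norm_sq) b < (nat \<circ> norm_sq) x"
      if "is_partition x" "is_partition b" "kostka x 0 b \<noteq> 0" for x b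
      using kostka_unitriangular(2)[OF that(2,3)] norm_sq_nonneg[of b] by auto
  qed
  from theI'[OF this] have "schur \<kappa> = (\<Sum>\<nu> | is_partition \<nu> \<and> kostka \<kappa> 0 \<nu> \<noteq> 0. of_int (kostka \<kappa> 0 \<nu>) * t_basis \<nu>)"
    unfolding t_basis_def using assms by blast
  also have "\<dots> = (\<Sum>\<nu>\<in>partitions (weight \<kappa>). of_int (kostka \<kappa> 0 \<nu>) * t_basis \<nu>)"
    by (rule sum.mono_neutral_left[OF finite_partitions sub]) (auto simp: partitions_def)
  finally show ?thesis .
qed

text \<open>Compare coefficients in \<open>u\<^sub>\<nu> U\<^sub>\<mu> = \<Sum>\<^sub>\<rho> K(\<rho>, \<nu>) U\<^sub>\<rho> U\<^sub>\<mu>\<close>.\<close>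

lemma kostka_skew_eq:
  assumes \<mu>: "is_partition \<mu>" and \<nu>: "\<nu> \<in> partitions N"
  shows "kostka \<kappa> \<mu> \<nu> = (\<Sum>\<rho>\<in>partitions N.
    kostka \<rho> 0 \<nu> * Poly_Mapping.lookup (schur_coeffs (schur \<rho> * schur \<mu>)) \<kappa>)"
proof -
  have \<nu>': "is_partition \<nu>" "weight \<nu> = N" using \<nu> by (auto simp: partitions_def)
  define c where "c = schur_coeffs (u_vec \<nu>)"
  have c: "Poly_Mapping.keys c \<subseteq> partitions N"
    using u_vec_mult_schur[OF \<nu>'(1) is_partition_0] \<nu>'(2) by (auto simp: c_def partitions_def)
  have "u_vec \<nu> = schur_sum c" by (simp add: c_def schur_sum_schur_coeffs)
  also have "\<dots> = (\<Sum>\<rho>\<in>partitions N. of_int (Poly_Mapping.lookup c \<rho>) * schur \<rho>)"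
    unfolding frag_extend_def using c
    by (intro sum.mono_neutral_cong_left) (auto simp: in_keys_iff frag_cmul_eq)
  finally have "u_vec \<nu> * schur \<mu> = (\<Sum>\<rho>\<in>partitions N. of_int (Poly_Mapping.lookup c \<rho>) * (schur \<rho> * schur \<mu>))"
    by (simp add: sum_distrib_right mult.assoc)
  moreover have "kostka \<rho> 0 \<nu> = Poly_Mapping.lookup c \<rho>" for \<rho>
    using \<nu>' by (simp add: kostka_eq c_def)
  ultimately show ?thesis
    using \<nu>' \<mu> by (simp add: kostka_eq[of \<nu> \<mu>] schur_coeffs_sum schur_coeffs_of_int_mult lookup_sum_pm)
qed

lemma skew_schur_eq:
  assumes \<mu>: "is_partition \<mu>"
  shows "skew_schur \<kappa> \<mu> = (\<Sum>\<rho>\<in>partitions (weight \<kappa> - weight \<mu>).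
    of_int (Poly_Mapping.lookup (schur_coeffs (schur \<rho> * schur \<mu>)) \<kappa>) * schur \<rho>)"
proof -
  let ?P = "partitions (weight \<kappa> - weight \<mu>)"
  let ?c = "\<lambda>\<rho>. Poly_Mapping.lookup (schur_coeffs (schur \<rho> * schur \<mu>)) \<kappa>"
  have "skew_schur \<kappa> \<mu> = (\<Sum>\<nu>\<in>?P. of_int (kostka \<kappa> \<mu> \<nu>) * t_basis \<nu>)"
    unfolding skew_schur_def
    using kostka_nonzero[OF _ \<mu>, of _ \<kappa>] by (intro sum.mono_neutral_left[OF finite_partitions]) (auto simp: partitions_def)
  also have "\<dots> = (\<Sum>\<nu>\<in>?P. \<Sum>\<rho>\<in>?P. of_int (?c \<rho>) * (of_int (kostka \<rho> 0 \<nu>) * t_basis \<nu>))"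
    by (intro sum.cong refl) (simp add: kostka_skew_eq[OF \<mu>] sum_distrib_right sum_distrib_left mult_ac)
  also have "\<dots> = (\<Sum>\<rho>\<in>?P. of_int (?c \<rho>) * (\<Sum>\<nu>\<in>?P. of_int (kostka \<rho> 0 \<nu>) * t_basis \<nu>))"
    by (subst sum.swap) (simp add: sum_distrib_left)
  also have "\<dots> = (\<Sum>\<rho>\<in>?P. of_int (?c \<rho>) * schur \<rho>)"
    by (intro sum.cong refl) (auto simp: partitions_def schur_eq_t_basis)
  finally show ?thesis .
qed

text \<open>Both sides are expanded by \<open>skew_schur_eq\<close>; conjugation permutes the partitions of the given
weight and preserves the structure constants.\<close>

theorem mainTheorem7:
  fixes lam mu :: int_vec
  assumes "is_partition lam" and "is_partition mu" and "young_le mu lam"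
  shows "omega_hom (skew_schur lam mu) = skew_schur (conj_part lam) (conj_part mu)"
proof -
  let ?P = "partitions (weight lam - weight mu)"
  let ?c = "\<lambda>\<rho> \<mu> \<kappa>. Poly_Mapping.lookup (schur_coeffs (schur \<rho> * schur \<mu>)) \<kappa>"
  have add: "omega_hom (f + g) = omega_hom f + omega_hom g" and mult: "omega_hom (f * g) = omega_hom f * omega_hom g"
    for f g using omega_ring_hom by (auto simp: is_ring_hom_def)
  have omega_0: "omega_hom 0 = 0" using add[of 0 0] by simp
  have omega_sum: "omega_hom (\<Sum>x\<in>A. f x) = (\<Sum>x\<in>A. omega_hom (f x))" for f :: "int_vec \<Rightarrow> poly_ring" and A
    by (induction A rule: infinite_finite_induct) (auto simp: add omega_0)
  have omega_of_int: "omega_hom (of_int k * f) = of_int k * omega_hom f" for k f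
    unfolding omega_schur_coeffs[of f] omega_schur_coeffs[of "of_int k * f"] schur_coeffs_of_int_mult
    by (simp add: frag_extend_cmul frag_cmul_eq)
  have "omega_hom (skew_schur lam mu) = (\<Sum>\<rho>\<in>?P. of_int (?c \<rho> mu lam) * omega_hom (schur \<rho>))"
    using assms(2) by (simp add: skew_schur_eq omega_sum omega_of_int)
  also have "\<dots> = (\<Sum>\<rho>\<in>?P. of_int (?c \<rho> (conj_part mu) (conj_part lam)) * schur \<rho>)"
  proof (rule sum.reindex_bij_witness[of _ conj_part conj_part])
    fix \<rho> assume "\<rho> \<in> ?P"
    then have \<rho>: "is_partition \<rho>" by (simp add: partitions_def)
    have "?c (conj_part \<rho>) (conj_part mu) (conj_part lam) = ?c \<rho> mu lam"
      using schur_coeffs_omega[OF assms(1), of "schur \<rho> * schur mu"] \<rho> assms(2)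
      by (simp add: mult omega_schur)
    then show "of_int (?c (conj_part \<rho>) (conj_part mu) (conj_part lam)) * schur (conj_part \<rho>)
        = of_int (?c \<rho> mu lam) * omega_hom (schur \<rho>)"
      using \<rho> by (simp add: omega_schur)
  qed (auto simp: partitions_def conj_part_conj_part is_partition_conj_part weight_conj_part)
  also have "\<dots> = skew_schur (conj_part lam) (conj_part mu)"
    using assms by (simp add: skew_schur_eq is_partition_conj_part weight_conj_part)
  finally show ?thesis .
qed

end
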